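(* Let $G$ be a finitely generated monoid. Then each of $\mathbf{SSP}(G)$, $\mathbf{BKP}(G)$, $\mathbf{BSMP}(G)$ is $\mathbf{P}$-time reducible to $\mathbf{AGWP}(G)$.
   Context: Let $G$ be a monoid generated by a finite set $X$; elements of $G$ are given as words over $X$ (over $X\cup X^{-1}$ if $G$ is a group). Complexity does not depend on the choice of finite $X$. $\mathbf{SSP}(G)$: given $g_1,\dots,g_k,g\in G$, decide whether $g=g_1^{\varepsilon_1}\cdots g_k^{\varepsilon_k}$ for some $\varepsilon_1,\dots,\varepsilon_k\in\{0,1\}$. $\mathbf{BKP}(G)$: given $g_1,\dots,g_k,g\in G$ and a positive integer $m$ in unary, decide whether $g=g_1^{\varepsilon_1}\cdots g_k^{\varepsilon_k}$ for some integers $0\le\varepsilon_j\le m$. $\mathbf{BSMP}(G)$: given $g_1,\dots,g_k,g\in G$ and a positive integer $m$ in unary, decide whether $g=g_{i_1}\cdots g_{i_s}$ for some integer $0\le s\le m$ and some $g_{i_1},\dots,g_{i_s}\in\{g_1,\dots,g_k\}$. $\mathbf{AGWP}(G)$: given a finite acyclic directed graph $\Gamma$ with edges labeled by letters in $X\cup\{\varepsilon\}$ ($\varepsilon$ the empty word), two marked vertices $\alpha,\omega$, and a word $w_0$ in $X$, decide whether there is an oriented path in $\Gamma$ from $\alpha$ to $\omega$ labeled by a word $w$ with $w=w_0$ in $G$. (If $G$ is a group, this is linear-time equivalent to the version with labels in $X\cup X^{-1}\cup\{\varepsilon\}$ and $w_0=1$.) A decision problem $(I_1,D_1)$ (instances,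 positive instances) is $\mathbf{P}$-time reducible to $(I_2,D_2)$ if there is a polynomial-time computable $f:I_1\to I_2$ with $u\in D_1\iff f(u)\in D_2$ for all $u\in I_1$. *)

theory Defs
  imports
    Main
    "HOL-Computational_Algebra.Polynomial"
    "HOL-Algebra.Generated_Groups"
    "Graph_Theory.Arc_Walk"
begin

section \<open>Polynomial-time computation\<close>

text \<open>
  The machine model is the deterministic Turing machine with a fixed finite number of tapes, all
  infinite in both directions. Tape cells carry elements of the type below. As it has infinitely
  many elements, the (finite) tape alphabet of a machine may contain any number of symbols besides
  those that occur in its input and output: every letter with a large index is available as an
  auxiliary symbol.
\<close>

datatype symbol = Blank | Sep | Tick | Eps | Letter nat

datatype direction = Go_left | Stay | Go_right

record turing_machine =
  tm_states :: "nat set"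
  tm_start :: nat
  tm_alphabet :: "symbol set"
  tm_tapes :: nat
  tm_delta :: "nat \<Rightarrow> symbol list \<Rightarrow> (nat \<times> (symbol \<times> direction) list) option"

text \<open>
  The transition function takes the state and the list of scanned symbols, one per tape, to the next
  state and, for each tape, the symbol to write and the move. The machine halts where it is
  undefined. There are at least two tapes: tape 0 holds the input, tape 1 receives the output.
\<close>

definition wf_tm :: "turing_machine \<Rightarrow> bool" where
  "wf_tm M \<longleftrightarrow>
     finite (tm_states M) \<and> tm_start M \<in> tm_states M \<and>
     finite (tm_alphabet M) \<and> Blank \<in> tm_alphabet M \<and>
     2 \<le> tm_tapes M \<and>
     (\<forall>q\<in>tm_states M. \<forall>rs\<in>lists (tm_alphabet M). length rs = tm_tapes M \<longrightarrow>
        (\<forall>q' as. tm_delta M q rs = Some (q', as) \<longrightarrow>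
           q' \<in> tm_states M \<and> length as = tm_tapes M \<and> fst ` set as \<subseteq> tm_alphabet M))"

text \<open>A tape is its content together with the position of the head.\<close>

type_synonym tape = "(int \<Rightarrow> symbol) \<times> int"

type_synonym config = "nat \<times> tape list"

definition written :: "symbol list \<Rightarrow> int \<Rightarrow> symbol" where
  "written xs = (\<lambda>i. if 0 \<le> i \<and> i < int (length xs) then xs ! nat i else Blank)"

definition scanned :: "tape \<Rightarrow> symbol" where
  "scanned t = fst t (snd t)"

fun offset :: "direction \<Rightarrow> int" where
  "offset Go_left = -1"
| "offset Stay = 0"
| "offset Go_right = 1"

definition tape_act :: "symbol \<times> direction \<Rightarrow> tape \<Rightarrow> tape" where
  "tape_act a t = ((fst t)(snd t := fst a), snd t + offset (snd a))"

definition tm_step :: "turing_machine \<Rightarrow> config \<Rightarrow> config" where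
  "tm_step M c = (case tm_delta M (fst c) (map scanned (snd c)) of
       None \<Rightarrow> c
     | Some (q', as) \<Rightarrow> (q', map2 tape_act as (snd c)))"

definition tm_halted :: "turing_machine \<Rightarrow> config \<Rightarrow> bool" where
  "tm_halted M c \<longleftrightarrow> tm_delta M (fst c) (map scanned (snd c)) = None"

definition tm_init :: "turing_machine \<Rightarrow> symbol list \<Rightarrow> config" where
  "tm_init M x = (tm_start M, (written x, 0) # replicate (tm_tapes M - 1) (written [], 0))"

text \<open>The position of the head and the contents of the tapes other than tape 1 are irrelevant on halting.\<close>

definition tm_computes_within :: "turing_machine \<Rightarrow> symbol list \<Rightarrow> symbol list \<Rightarrow> nat \<Rightarrow> bool" where
  "tm_computes_within M x y t \<longleftrightarrow>
     (\<exists>s\<le>t. let c = (tm_step M ^^ s) (tm_init M x)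
             in tm_halted M c \<and> fst (snd c ! 1) = written y)"

section \<open>Decision problems and reductions\<close>

record 'i decision_problem =
  instances :: "'i set"
  positives :: "'i set"
  encoding :: "'i \<Rightarrow> symbol list"

text \<open>
  The function need only be computed on (encodings of) instances, as it is only defined there. Each
  encoding used below is injective and free of blanks (see the lemmas that follow it).
\<close>

definition polytime_computable ::
    "'i decision_problem \<Rightarrow> 'j decision_problem \<Rightarrow> ('i \<Rightarrow> 'j) \<Rightarrow> bool" where
  "polytime_computable A B f \<longleftrightarrow>
     (\<exists>M p. wf_tm M \<and>
        (\<forall>u\<in>instances A. set (encoding A u) \<subseteq> tm_alphabet M \<and>
           tm_computes_within M (encoding A u) (encoding B (f u))
             (poly (p :: nat poly) (length (encoding A u)))))"

definition P_reducible :: "'i decision_problem \<Rightarrow> 'j decision_problem \<Rightarrow> bool" where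
  "P_reducible A B \<longleftrightarrow>
     (\<exists>f. f \<in> instances A \<rightarrow> instances B \<and> polytime_computable A B f \<and>
        (\<forall>u\<in>instances A. u \<in> positives A \<longleftrightarrow> f u \<in> positives B))"

section \<open>Words over a finite generating set\<close>

definition monoid_prod :: "('g, 'b) monoid_scheme \<Rightarrow> 'g list \<Rightarrow> 'g" where
  "monoid_prod G xs = foldr (\<lambda>x y. x \<otimes>\<^bsub>G\<^esub> y) xs \<one>\<^bsub>G\<^esub>"

text \<open>
  The finite set of generators is given as a list, and the letter \<open>i\<close> stands for its entry number
  \<open>i\<close>. Entries may repeat, so that for a group the formal alphabet made of the generators and
  their formal inverses is the list \<open>xs @ map inv xs\<close>: see the lemma at the end of this section.
\<close>

type_synonym word = "nat list"

definition words :: "'g list \<Rightarrow> word set" where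
  "words X = lists {..<length X}"

definition word_val :: "('g, 'b) monoid_scheme \<Rightarrow> 'g list \<Rightarrow> word \<Rightarrow> 'g" where
  "word_val G X w = monoid_prod G (map (\<lambda>i. X ! i) w)"

definition generated_by :: "('g, 'b) monoid_scheme \<Rightarrow> 'g list \<Rightarrow> bool" where
  "generated_by G X \<longleftrightarrow> set X \<subseteq> carrier G \<and> carrier G = word_val G X ` words X"

lemma (in monoid) monoid_prod_closed:
  "set xs \<subseteq> carrier G \<Longrightarrow> monoid_prod G xs \<in> carrier G"
  by (induction xs) (auto simp: monoid_prod_def)

lemma (in monoid) monoid_prod_append:
  "set xs \<subseteq> carrier G \<Longrightarrow> set ys \<subseteq> carrier G \<Longrightarrow>
     monoid_prod G (xs @ ys) = monoid_prod G xs \<otimes> monoid_prod G ys"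
proof (induction xs)
  case Nil
  then show ?case using monoid_prod_closed[of ys] by (simp add: monoid_prod_def)
next
  case (Cons x xs)
  then show ?case
    using monoid_prod_closed[of xs] monoid_prod_closed[of ys]
    by (simp add: monoid_prod_def m_assoc)
qed

lemma word_val_image: "word_val G X ` words X = monoid_prod G ` lists (set X)"
proof -
  have "set X = (\<lambda>i. X ! i) ` {..<length X}"
    by (auto simp: in_set_conv_nth)
  then have "lists (set X) = map (\<lambda>i. X ! i) ` lists {..<length X}"
    by (simp only: lists_image)
  then show ?thesis
    by (auto simp: word_val_def words_def)
qed

lemma (in group) group_generated_by:
  assumes "set xs \<subseteq> carrier G" and gen: "generate G (set xs) = carrier G"
  shows "generated_by G (xs @ map (\<lambda>x. inv x) xs)"
proof -
  let ?X = "set (xs @ map (\<lambda>x. inv x) xs)"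
  have X: "?X \<subseteq> carrier G" using assms(1) by auto
  have 1: "\<exists>ws\<in>lists ?X. g = monoid_prod G ws" if "g \<in> generate G (set xs)" for g
    using that
  proof (induction rule: generate.induct)
    case one
    show ?case by (rule bexI[of _ "[]"]) (auto simp: monoid_prod_def)
  next
    case (incl h)
    then show ?case using assms(1) by (intro bexI[of _ "[h]"]) (auto simp: monoid_prod_def)
  next
    case (inv h)
    then show ?case using assms(1) by (intro bexI[of _ "[inv h]"]) (auto simp: monoid_prod_def)
  next
    case (eng g h)
    then obtain us vs where "us \<in> lists ?X" "vs \<in> lists ?X"
      "g = monoid_prod G us" "h = monoid_prod G vs"
      by blast
    then show ?case using X
      by (intro bexI[of _ "us @ vs"]) (auto simp: in_lists_conv_set intro!: monoid_prod_append[symmetric])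
  qed
  have 2: "monoid_prod G ws \<in> carrier G" if "ws \<in> lists ?X" for ws
    using that X by (intro monoid_prod_closed) blast
  show ?thesis
    unfolding generated_by_def word_val_image using X 1 2 gen by blast
qed

section \<open>Encodings\<close>

definition enc_list :: "('a \<Rightarrow> symbol list) \<Rightarrow> 'a list \<Rightarrow> symbol list" where
  "enc_list e xs = concat (map (\<lambda>x. Tick # e x) xs) @ [Sep]"

definition enc_unary :: "nat \<Rightarrow> symbol list" where
  "enc_unary n = replicate n Tick @ [Sep]"

definition enc_word :: "word \<Rightarrow> symbol list" where
  "enc_word w = map Letter w @ [Sep]"

fun enc_label :: "nat option \<Rightarrow> symbol list" where
  "enc_label None = [Eps]"
| "enc_label (Some i) = [Letter i]"

definition prefix_free_enc :: "('a \<Rightarrow> symbol list) \<Rightarrow> bool" where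
  "prefix_free_enc e \<longleftrightarrow>
     (\<forall>x y r s. e x @ r = e y @ s \<longrightarrow> x = y \<and> r = s) \<and> (\<forall>x. Blank \<notin> set (e x))"

lemma prefix_free_encD: "prefix_free_enc e \<Longrightarrow> e x @ r = e y @ s \<longleftrightarrow> x = y \<and> r = s"
  unfolding prefix_free_enc_def by blast

lemma prefix_free_enc_blank: "prefix_free_enc e \<Longrightarrow> Blank \<notin> set (e x)"
  unfolding prefix_free_enc_def by blast

lemma prefix_free_encI:
  assumes "\<And>x y r s. e x @ r = e y @ s \<Longrightarrow> x = y \<and> r = s" and "\<And>x. Blank \<notin> set (e x)"
  shows "prefix_free_enc e"
  unfolding prefix_free_enc_def using assms by blast

lemma prefix_free_enc_inj: "prefix_free_enc e \<Longrightarrow> inj e"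
  unfolding prefix_free_enc_def inj_def by (metis append_Nil2)

lemma prefix_free_unary: "prefix_free_enc enc_unary"
proof -
  have "x = y \<and> r = s" if "enc_unary x @ r = enc_unary y @ s" for x y r s
    using that
  proof (induction x arbitrary: y)
    case 0
    then show ?case by (cases y) (auto simp: enc_unary_def)
  next
    case (Suc x)
    then show ?case by (cases y) (auto simp: enc_unary_def)
  qed
  moreover have "Blank \<notin> set (enc_unary x)" for x by (auto simp: enc_unary_def)
  ultimately show ?thesis by (rule prefix_free_encI)
qed

lemma prefix_free_word: "prefix_free_enc enc_word"
proof -
  have "x = y \<and> r = s" if "enc_word x @ r = enc_word y @ s" for x y r s
    using that
  proof (induction x arbitrary: y)
    case Nil
    then show ?case by (cases y) (auto simp: enc_word_def)
  next
    case (Cons a x)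
    then show ?case by (cases y) (auto simp: enc_word_def)
  qed
  moreover have "Blank \<notin> set (enc_word x)" for x by (auto simp: enc_word_def)
  ultimately show ?thesis by (rule prefix_free_encI)
qed

lemma prefix_free_label: "prefix_free_enc enc_label"
proof -
  have "x = y \<and> r = s" if "enc_label x @ r = enc_label y @ s" for x y r s
    using that by (cases x; cases y) auto
  moreover have "Blank \<notin> set (enc_label x)" for x by (cases x) auto
  ultimately show ?thesis by (rule prefix_free_encI)
qed

lemma prefix_free_list:
  assumes "prefix_free_enc e"
  shows "prefix_free_enc (enc_list e)"
proof -
  have "x = y \<and> r = s" if "enc_list e x @ r = enc_list e y @ s" for x y r s
    using that
  proof (induction x arbitrary: y)
    case Nil
    then show ?case by (cases y) (auto simp: enc_list_def)
  next
    case (Cons a x)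
    from Cons.prems obtain b y' where y: "y = b # y'"
      by (cases y) (auto simp: enc_list_def)
    with Cons.prems have "e a @ enc_list e x @ r = e b @ enc_list e y' @ s"
      by (simp add: enc_list_def)
    then have "a = b" "enc_list e x @ r = enc_list e y' @ s"
      using prefix_free_encD[OF assms] by blast+
    with Cons.IH[of y'] y show ?case by simp
  qed
  moreover have "Blank \<notin> set (enc_list e x)" for x
    using prefix_free_enc_blank[OF assms] by (auto simp: enc_list_def)
  ultimately show ?thesis by (rule prefix_free_encI)
qed

section \<open>Subset sum, bounded knapsack and bounded submonoid membership\<close>

type_synonym SSP_instance = "word list \<times> word"

fun enc_SSP :: "SSP_instance \<Rightarrow> symbol list" where
  "enc_SSP (gs, g) = enc_list enc_word gs @ enc_word g"

fun instance_SSP :: "'g list \<Rightarrow> SSP_instance \<Rightarrow> bool" where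
  "instance_SSP X (gs, g) \<longleftrightarrow> set gs \<subseteq> words X \<and> g \<in> words X"

fun positive_SSP :: "('g, 'b) monoid_scheme \<Rightarrow> 'g list \<Rightarrow> SSP_instance \<Rightarrow> bool" where
  "positive_SSP G X (gs, g) \<longleftrightarrow>
     (\<exists>es :: nat list. length es = length gs \<and> set es \<subseteq> {0, 1} \<and>
        word_val G X g = monoid_prod G (map2 (\<lambda>h e. word_val G X h [^]\<^bsub>G\<^esub> e) gs es))"

definition SSP :: "('g, 'b) monoid_scheme \<Rightarrow> 'g list \<Rightarrow> SSP_instance decision_problem" where
  "SSP G X = \<lparr>instances = {u. instance_SSP X u},
     positives = {u. instance_SSP X u \<and> positive_SSP G X u},
     encoding = enc_SSP\<rparr>"

text \<open>
  The instances of the bounded knapsack and of the bounded submonoid membership problem have the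
  same form; the bound is encoded in unary.
\<close>

type_synonym bounded_instance = "word list \<times> word \<times> nat"

fun enc_bounded :: "bounded_instance \<Rightarrow> symbol list" where
  "enc_bounded (gs, g, m) = enc_list enc_word gs @ enc_word g @ enc_unary m"

fun instance_bounded :: "'g list \<Rightarrow> bounded_instance \<Rightarrow> bool" where
  "instance_bounded X (gs, g, m) \<longleftrightarrow> set gs \<subseteq> words X \<and> g \<in> words X \<and> 1 \<le> m"

fun positive_BKP :: "('g, 'b) monoid_scheme \<Rightarrow> 'g list \<Rightarrow> bounded_instance \<Rightarrow> bool" where
  "positive_BKP G X (gs, g, m) \<longleftrightarrow>
     (\<exists>es :: nat list. length es = length gs \<and> set es \<subseteq> {0..m} \<and>
        word_val G X g = monoid_prod G (map2 (\<lambda>h e. word_val G X h [^]\<^bsub>G\<^esub> e) gs es))"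

definition BKP :: "('g, 'b) monoid_scheme \<Rightarrow> 'g list \<Rightarrow> bounded_instance decision_problem" where
  "BKP G X = \<lparr>instances = {u. instance_bounded X u},
     positives = {u. instance_bounded X u \<and> positive_BKP G X u},
     encoding = enc_bounded\<rparr>"

fun positive_BSMP :: "('g, 'b) monoid_scheme \<Rightarrow> 'g list \<Rightarrow> bounded_instance \<Rightarrow> bool" where
  "positive_BSMP G X (gs, g, m) \<longleftrightarrow>
     (\<exists>hs. length hs \<le> m \<and> set hs \<subseteq> set gs \<and>
        word_val G X g = monoid_prod G (map (word_val G X) hs))"

definition BSMP :: "('g, 'b) monoid_scheme \<Rightarrow> 'g list \<Rightarrow> bounded_instance decision_problem" where
  "BSMP G X = \<lparr>instances = {u. instance_bounded X u},
     positives = {u. instance_bounded X u \<and> positive_BSMP G X u},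
     encoding = enc_bounded\<rparr>"

section \<open>The acyclic graph word problem\<close>

text \<open>
  An instance \<open>(n, es, \<alpha>, \<omega>, w\<^sub>0)\<close> has the vertices \<open>0, \<dots>, n - 1\<close> and the list \<open>es\<close> of edges
  (tail, label, head), where the label \<open>None\<close> is the empty word. Parallel edges with different
  labels are allowed. The encoding writes vertices in unary; since \<open>n\<close> vertices count as size \<open>n\<close>
  in any case, this is polynomially equivalent to writing their names in binary.
\<close>

type_synonym edge = "nat \<times> nat option \<times> nat"

type_synonym AGWP_instance = "nat \<times> edge list \<times> nat \<times> nat \<times> word"

definition edge_label :: "edge \<Rightarrow> nat option" where
  "edge_label e = fst (snd e)"

definition labelled_graph :: "nat \<Rightarrow> edge list \<Rightarrow> (nat, edge) pre_digraph" where
  "labelled_graph n es = \<lparr>verts = {..<n}, arcs = set es, tail = fst, head = (\<lambda>e. snd (snd e))\<rparr>"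

fun enc_edge :: "edge \<Rightarrow> symbol list" where
  "enc_edge (u, l, v) = enc_unary u @ enc_label l @ enc_unary v"

fun enc_AGWP :: "AGWP_instance \<Rightarrow> symbol list" where
  "enc_AGWP (n, es, \<alpha>, \<omega>, w\<^sub>0) =
     enc_unary n @ enc_list enc_edge es @ enc_unary \<alpha> @ enc_unary \<omega> @ enc_word w\<^sub>0"

fun instance_AGWP :: "'g list \<Rightarrow> AGWP_instance \<Rightarrow> bool" where
  "instance_AGWP X (n, es, \<alpha>, \<omega>, w\<^sub>0) \<longleftrightarrow>
     fin_digraph (labelled_graph n es) \<and>
     (\<nexists>p. pre_digraph.cycle (labelled_graph n es) p) \<and>
     (\<forall>e\<in>set es. set_option (edge_label e) \<subseteq> {..<length X}) \<and>
     \<alpha> \<in> verts (labelled_graph n es) \<and> \<omega> \<in> verts (labelled_graph n es) \<and>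
     w\<^sub>0 \<in> words X"

fun positive_AGWP :: "('g, 'b) monoid_scheme \<Rightarrow> 'g list \<Rightarrow> AGWP_instance \<Rightarrow> bool" where
  "positive_AGWP G X (n, es, \<alpha>, \<omega>, w\<^sub>0) \<longleftrightarrow>
     (\<exists>p. pre_digraph.awalk (labelled_graph n es) \<alpha> p \<omega> \<and>
        word_val G X (List.map_filter edge_label p) = word_val G X w\<^sub>0)"

definition AGWP :: "('g, 'b) monoid_scheme \<Rightarrow> 'g list \<Rightarrow> AGWP_instance decision_problem" where
  "AGWP G X = \<lparr>instances = {u. instance_AGWP X u},
     positives = {u. instance_AGWP X u \<and> positive_AGWP G X u},
     encoding = enc_AGWP\<rparr>"

section \<open>The encodings are injective and free of blanks\<close>

lemma prefix_free_edge: "prefix_free_enc enc_edge"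
proof -
  have "x = y \<and> r = s" if "enc_edge x @ r = enc_edge y @ s" for x y r s
    using that
    by (cases x; cases y)
      (auto simp: prefix_free_encD[OF prefix_free_unary] prefix_free_encD[OF prefix_free_label])
  moreover have "Blank \<notin> set (enc_edge x)" for x
    by (cases x)
      (auto simp: prefix_free_enc_blank[OF prefix_free_unary] prefix_free_enc_blank[OF prefix_free_label])
  ultimately show ?thesis by (rule prefix_free_encI)
qed

lemmas prefix_free_encs =
  prefix_free_unary prefix_free_word prefix_free_edge
  prefix_free_list[OF prefix_free_word] prefix_free_list[OF prefix_free_edge]

lemma prefix_free_SSP: "prefix_free_enc enc_SSP"
proof -
  have "x = y \<and> r = s" if "enc_SSP x @ r = enc_SSP y @ s" for x y r s
    using that by (cases x; cases y) (auto simp: prefix_free_encs[THEN prefix_free_encD])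
  moreover have "Blank \<notin> set (enc_SSP x)" for x
    by (cases x) (auto simp: prefix_free_encs[THEN prefix_free_enc_blank])
  ultimately show ?thesis by (rule prefix_free_encI)
qed

lemma prefix_free_bounded: "prefix_free_enc enc_bounded"
proof -
  have "x = y \<and> r = s" if "enc_bounded x @ r = enc_bounded y @ s" for x y r s
    using that by (cases x; cases y) (auto simp: prefix_free_encs[THEN prefix_free_encD])
  moreover have "Blank \<notin> set (enc_bounded x)" for x
    by (cases x) (auto simp: prefix_free_encs[THEN prefix_free_enc_blank])
  ultimately show ?thesis by (rule prefix_free_encI)
qed

lemma prefix_free_AGWP: "prefix_free_enc enc_AGWP"
proof -
  have "x = y \<and> r = s" if "enc_AGWP x @ r = enc_AGWP y @ s" for x y r s
    using that by (cases x; cases y) (auto simp: prefix_free_encs[THEN prefix_free_encD])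
  moreover have "Blank \<notin> set (enc_AGWP x)" for x
    by (cases x) (auto simp: prefix_free_encs[THEN prefix_free_enc_blank])
  ultimately show ?thesis by (rule prefix_free_encI)
qed

end

theory Submission
  imports Defs
begin

text \<open>
  All three problems ask whether some word of a certain finite set has the same value as \<open>g\<close>, and
  each of these sets consists of the labels of the paths in an acyclic graph of polynomial size. The
  graph is described by a \<^emph>\<open>script\<close>: the list of words \<open>g\<^sub>1, \<dots>, g\<^sub>k\<close>, spelled out with separators, in
  which everything that may be used several times is repeated. For the bounded knapsack each word is
  repeated \<open>m\<close> times in place, and every copy may be taken or skipped; subset sum is the case
  \<open>m = 1\<close>. For bounded submonoid membership the whole list is repeated \<open>m\<close> times, and from every copy
  of the list at most one word is taken.

  A nondeterministic automaton with three states reads the script and outputs the word that is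
  spelled by its choices. Unrolling it along the script, with one layer of three vertices per
  position, gives an acyclic graph whose paths from state \<open>0\<close> in the first layer to state \<open>0\<close> in the
  last layer are exactly the runs of the automaton, labelled by their outputs
  (\<open>positive_unrolled_graph\<close>). The outputs are computed in \<open>outputs_knapsack_script\<close> and
  \<open>outputs_membership_script\<close>; associativity turns the value of the spelled word into the product
  that occurs in the problem.

  The reduction is easy to compute because an edge joins consecutive layers and depends only on the
  symbol at one position. Vertices being written in unary, a Turing machine can produce the list of
  edges while it reads the script and holds the current position on a counter tape. The machine is
  written in a small assembly language of relocatable instruction lists. The judgement
  \<open>runs P \<sigma> n \<tau>\<close> states the effect of \<open>P\<close> together with a bound on the number of steps, and it
  composes along sequences, conditionals and loops. A run has three phases: the bound \<open>m\<close> is loaded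
  (\<open>runs_load_bound\<close>, \<open>runs_load_one\<close>), the script is written (\<open>runs_unroll_knapsack\<close>,
  \<open>runs_unroll_membership\<close>), and the graph is printed (\<open>runs_emit_graph\<close>). A script is at most
  quadratic in the length of the input, and printing takes time quadratic in the length of the
  script, which gives the polynomial bound.
\<close>

section \<open>Scripts\<close>

text \<open>
  The symbol \<open>Tick\<close> offers the choice to take the word that follows. The terminator \<open>t\<close> decides
  what happens after the word was taken: after \<open>Sep\<close> all further words are skipped up to the next
  \<open>Eps\<close>, whereas \<open>Eps\<close> makes the next word available at once. With \<open>t = Sep\<close> this is the way in
  which the words are written in the input.
\<close>

definition mark_word :: "symbol \<Rightarrow> word \<Rightarrow> symbol list" where
  "mark_word t w = Tick # map Letter w @ [t]"

definition knapsack_script :: "word list \<Rightarrow> nat \<Rightarrow> symbol list" where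
  "knapsack_script ws m = concat (map (\<lambda>w. concat (replicate m (mark_word Eps w))) ws)"

definition membership_script :: "word list \<Rightarrow> nat \<Rightarrow> symbol list" where
  "membership_script ws m = concat (replicate m (concat (map (mark_word Sep) ws) @ [Eps]))"

lemma enc_list_words: "enc_list enc_word ws = concat (map (mark_word Sep) ws) @ [Sep]"
  by (simp add: enc_list_def enc_word_def[abs_def] mark_word_def[abs_def])

lemma length_le_enc_list: "length ws \<le> length (enc_list enc_word ws)"
  unfolding enc_list_words by (induction ws) (auto simp: mark_word_def)

lemma word_length_le_enc_list: "w \<in> set ws \<Longrightarrow> length w \<le> length (enc_list enc_word ws)"
  unfolding enc_list_words by (induction ws) (auto simp: mark_word_def)

lemma length_knapsack_script: "length (knapsack_script ws m) \<le> m * length (enc_list enc_word ws)"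
  unfolding enc_list_words knapsack_script_def
  by (induction ws) (auto simp: length_concat sum_list_replicate mark_word_def algebra_simps)

lemma length_membership_script: "length (membership_script ws m) \<le> m * length (enc_list enc_word ws)"
  by (simp add: enc_list_words membership_script_def length_concat sum_list_replicate)

definition script_symbols :: "'g list \<Rightarrow> symbol set" where
  "script_symbols X = {Sep, Tick, Eps} \<union> Letter ` {..<length X}"

lemma set_enc_word: "w \<in> words X \<Longrightarrow> set (enc_word w) \<subseteq> script_symbols X"
  by (auto simp: enc_word_def words_def script_symbols_def)

lemma set_mark_word: "w \<in> words X \<Longrightarrow> t \<in> script_symbols X \<Longrightarrow> set (mark_word t w) \<subseteq> script_symbols X"
  by (auto simp: mark_word_def words_def script_symbols_def)

lemma set_enc_list_words: "set ws \<subseteq> words X \<Longrightarrow> set (enc_list enc_word ws) \<subseteq> script_symbols X"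
  using set_enc_word[of _ X] by (auto simp: enc_list_def script_symbols_def)

lemma set_knapsack_script:
  assumes "set ws \<subseteq> words X"
  shows "set (knapsack_script ws m) \<subseteq> script_symbols X"
proof -
  have "set (mark_word Eps w) \<subseteq> script_symbols X" if "w \<in> set ws" for w
    using that assms by (intro set_mark_word) (auto simp: script_symbols_def)
  then show ?thesis by (auto simp: knapsack_script_def subset_eq)
qed

lemma set_membership_script:
  assumes "set ws \<subseteq> words X"
  shows "set (membership_script ws m) \<subseteq> script_symbols X"
proof -
  have "set (mark_word Sep w) \<subseteq> script_symbols X" if "w \<in> set ws" for w
    using that assms by (intro set_mark_word) (auto simp: script_symbols_def)
  moreover have "Eps \<in> script_symbols X" by (simp add: script_symbols_def)
  ultimately show ?thesis by (auto simp: membership_script_def subset_eq)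
qed

lemma Blank_not_script: "xs \<subseteq> script_symbols X \<Longrightarrow> Blank \<notin> xs"
  by (auto simp: script_symbols_def)

section \<open>The choice automaton and its unrolling\<close>

fun is_letter :: "symbol \<Rightarrow> bool" where
  "is_letter (Letter a) = True"
| "is_letter _ = False"

type_synonym template = "(symbol \<Rightarrow> bool) \<times> nat \<times> (symbol \<Rightarrow> nat option) \<times> nat"

text \<open>
  The transitions of the automaton, each given by the symbols on which it is possible, the source
  state, the output, and the target state. In state \<open>0\<close> a word may be taken, in state \<open>1\<close> a word is
  being output, and in state \<open>2\<close> the choice of the current layer has been made. On \<open>Eps\<close> every state
  returns to \<open>0\<close>. The table is a list, so that the program that prints the edges can be built from it.
\<close>

definition templates :: "template list" where
  "templates =
    [(\<lambda>_. True, 0, \<lambda>_. None, 0),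
     (\<lambda>x. x = Tick, 0, \<lambda>_. None, 1),
     (is_letter, 1, \<lambda>x. case x of Letter a \<Rightarrow> Some a | _ \<Rightarrow> None, 1),
     (\<lambda>x. x = Sep, 1, \<lambda>_. None, 2),
     (\<lambda>x. x = Eps, 1, \<lambda>_. None, 0),
     (\<lambda>x. x \<noteq> Eps, 2, \<lambda>_. None, 2),
     (\<lambda>x. x = Eps, 2, \<lambda>_. None, 0)]"

definition moves_in ::
    "template list \<Rightarrow> symbol \<Rightarrow>
     (nat \<times> nat option \<times> nat) list" where
  "moves_in ts x = map (\<lambda>(b, i, l, j). (i, l x, j)) (filter (\<lambda>(b, i, l, j). b x) ts)"

text \<open>The vertex \<open>3 * p + i\<close> stands for state \<open>i\<close> in front of position \<open>p\<close> of the script.\<close>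

fun edge_at :: "nat \<Rightarrow> nat \<times> nat option \<times> nat \<Rightarrow> edge" where
  "edge_at p (i, l, j) = (3 * p + i, l, 3 * Suc p + j)"

fun unrolled_edges :: "nat \<Rightarrow> symbol list \<Rightarrow> edge list" where
  "unrolled_edges p [] = []"
| "unrolled_edges p (x # xs) = map (edge_at p) (moves_in templates x) @ unrolled_edges (Suc p) xs"

definition unrolled_graph :: "symbol list \<Rightarrow> word \<Rightarrow> AGWP_instance" where
  "unrolled_graph xs g = (3 * length xs + 3, unrolled_edges 0 xs, 0, 3 * length xs, g)"

lemma set_moves_in: "(i, l, k) \<in> set (moves_in ts x) \<longleftrightarrow> (\<exists>b f. (b, i, f, k) \<in> set ts \<and> b x \<and> l = f x)"
  by (force simp: moves_in_def)

lemma moves_Tick: "set (moves_in templates Tick) = {(0, None, 0), (0, None, 1), (2, None, 2)}"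
  and moves_Letter: "set (moves_in templates (Letter a)) = {(0, None, 0), (1, Some a, 1), (2, None, 2)}"
  and moves_Sep: "set (moves_in templates Sep) = {(0, None, 0), (1, None, 2), (2, None, 2)}"
  and moves_Eps: "set (moves_in templates Eps) = {(0, None, 0), (1, None, 0), (2, None, 0)}"
  by (auto simp: moves_in_def templates_def)

lemmas moves = moves_Tick moves_Letter moves_Sep moves_Eps

lemma moves_bound: "(i, l, j) \<in> set (moves_in templates x) \<Longrightarrow> i < 3 \<and> j < 3"
  by (auto simp: set_moves_in templates_def)

section \<open>Outputs of the automaton on a script\<close>

fun spell :: "nat option \<Rightarrow> word \<Rightarrow> word" where
  "spell None w = w"
| "spell (Some a) w = a # w"

text \<open>The words that the automaton can output when it reads a script from state \<open>i\<close> to state \<open>j\<close>.\<close>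

fun outputs :: "nat \<Rightarrow> symbol list \<Rightarrow> nat \<Rightarrow> word set" where
  "outputs i [] j = (if i = j then {[]} else {})"
| "outputs i (x # xs) j =
     (\<Union>(h, l, k)\<in>set (moves_in templates x). if h = i then spell l ` outputs k xs j else {})"

lemma outputs_Cons_iff:
  "w \<in> outputs i (x # xs) j \<longleftrightarrow>
     (\<exists>l k v. (i, l, k) \<in> set (moves_in templates x) \<and> v \<in> outputs k xs j \<and> w = spell l v)"
  by (fastforce split: if_splits)

lemma spell_image: "spell None ` A = A" "spell (Some a) ` A = (#) a ` A"
  by (auto simp: image_iff)

lemma spell_append: "spell l (v @ w) = spell l v @ w"
  by (cases l) auto

lemma outputs_bound: "w \<in> outputs i xs j \<Longrightarrow> i < 3 \<Longrightarrow> j < 3"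
proof (induction xs arbitrary: i w)
  case (Cons x xs)
  then show ?case using moves_bound unfolding outputs_Cons_iff by blast
qed (auto split: if_splits)

lemma outputs_append_iff:
  "w \<in> outputs i (xs @ ys) j \<longleftrightarrow>
     (\<exists>k u v. u \<in> outputs i xs k \<and> v \<in> outputs k ys j \<and> w = u @ v)"
proof (induction xs arbitrary: i w)
  case Nil
  show ?case by auto
next
  case (Cons x xs)
  show ?case
    unfolding append_Cons outputs_Cons_iff Cons.IH using spell_append by metis
qed

definition conc :: "word set \<Rightarrow> word set \<Rightarrow> word set" where
  "conc U V = {u @ v | u v. u \<in> U \<and> v \<in> V}"

lemma conc_simps:
  "conc {} V = {}" "conc U {} = {}" "conc {[]} V = V" "conc U {[]} = U"
  "conc (insert u U) V = (@) u ` V \<union> conc U V"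
  by (auto simp: conc_def)

text \<open>
  The intermediate state is made to range over an explicit set, so that the simplifier can
  compute the outputs of a concrete script symbol by symbol.
\<close>

lemma outputs_append:
  assumes "i < 3"
  shows "outputs i (xs @ ys) j = (\<Union>k\<in>{0, 1, 2}. conc (outputs i xs k) (outputs k ys j))"
proof -
  have "k \<in> {0, 1, 2}" if "u \<in> outputs i xs k" for u k
    using outputs_bound[OF that assms] by auto
  then have "w \<in> outputs i (xs @ ys) j \<longleftrightarrow>
      (\<exists>k\<in>{0, 1, 2}. w \<in> conc (outputs i xs k) (outputs k ys j))" for w
    unfolding outputs_append_iff Bex_def conc_def mem_Collect_eq by metis
  then show ?thesis by (simp only: set_eq_iff UN_iff) simp
qed

lemma outputs_letters:
  "outputs 0 (map Letter w) j = (if j = 0 then {[]} else {})"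
  "outputs (Suc 0) (map Letter w) j = (if j = Suc 0 then {w} else {})"
  "outputs 2 (map Letter w) j = (if j = 2 then {[]} else {})"
  by (induction w) (auto simp: moves spell_image)

lemma outputs_mark_Eps: "outputs 0 (mark_word Eps w) j = (if j = 0 then {[], w} else {})"
  by (auto simp: mark_word_def moves outputs_append outputs_letters spell_image conc_simps)

lemma outputs_mark_Sep:
  "outputs 0 (mark_word Sep w) j = (if j = 0 then {[]} else if j = 2 then {w} else {})"
  "outputs 2 (mark_word Sep w) j = (if j = 2 then {[]} else {})"
  by (auto simp: mark_word_def moves outputs_append outputs_letters spell_image conc_simps)

text \<open>
  State \<open>2\<close> cannot be left without \<open>Eps\<close>, so only one word of the list can be taken.
\<close>

lemma outputs_choice:
  "outputs 0 (concat (map (mark_word Sep) ws)) j =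
     (if j = 0 then {[]} else if j = 2 then set ws else {})"
  "outputs 2 (concat (map (mark_word Sep) ws)) j = (if j = 2 then {[]} else {})"
  by (induction ws) (auto simp: outputs_append outputs_mark_Sep conc_simps)

lemma outputs_layer:
  "outputs 0 (concat (map (mark_word Sep) ws) @ [Eps]) j = (if j = 0 then insert [] (set ws) else {})"
  by (auto simp: outputs_append outputs_choice moves spell_image conc_simps)

text \<open>
  Different subsets of the copies give the same output if they have the same size, so \<open>m\<close> optional
  copies produce the powers with exponent at most \<open>m\<close>.
\<close>

lemma outputs_repeat_word:
  "outputs 0 (concat (replicate m (mark_word Eps w))) j =
     (if j = 0 then {concat (replicate e w) | e. e \<le> m} else {})"
proof (induction m arbitrary: j)
  case 0
  show ?case by auto
next
  case (Suc m)
  have "{concat (replicate e w) | e. e \<le> Suc m} =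
      {concat (replicate e w) | e. e \<le> m} \<union> {w @ concat (replicate e w) | e. e \<le> m}"
    (is "?A = ?B \<union> ?C")
  proof (intro subset_antisym subsetI)
    fix x assume "x \<in> ?A"
    then obtain e where "x = concat (replicate e w)" "e \<le> Suc m" by auto
    then show "x \<in> ?B \<union> ?C" by (cases e) auto
  next
    fix x assume "x \<in> ?B \<union> ?C"
    then consider e where "x = concat (replicate e w)" "e \<le> m"
      | e where "x = concat (replicate (Suc e) w)" "e \<le> m"
      by auto
    then show "x \<in> ?A" by cases (auto intro: exI[of _ "Suc _"])
  qed
  then show ?case
    using Suc.IH by (auto simp: outputs_append outputs_mark_Eps conc_simps image_iff)
qed

lemma outputs_knapsack_script:
  "outputs 0 (knapsack_script ws m) j = (if j = 0
     then {concat (map2 (\<lambda>w e. concat (replicate e w)) ws es) | es. length es = length ws \<and> set es \<subseteq> {0..m}}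
     else {})"
proof (induction ws arbitrary: j)
  case Nil
  show ?case by (auto simp: knapsack_script_def)
next
  case (Cons w ws)
  \<comment> \<open>An exponent list for \<open>w # ws\<close> is an exponent for \<open>w\<close> followed by one for \<open>ws\<close>.\<close>
  have split: "knapsack_script (w # ws) m = concat (replicate m (mark_word Eps w)) @ knapsack_script ws m"
    by (simp add: knapsack_script_def)
  let ?f = "\<lambda>w e. concat (replicate e w)"
  have "{concat (map2 ?f (w # ws) es) | es. length es = length (w # ws) \<and> set es \<subseteq> {0..m}} =
     {u @ v | u v. (\<exists>e\<le>m. u = ?f w e) \<and>
        (\<exists>es. v = concat (map2 ?f ws es) \<and> length es = length ws \<and> set es \<subseteq> {0..m})}"
    (is "?A = ?B")
  proof (intro subset_antisym subsetI)
    fix x assume "x \<in> ?A"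
    then obtain es where *: "x = concat (map2 ?f (w # ws) es)" "length es = length (w # ws)" "set es \<subseteq> {0..m}"
      by auto
    then obtain e es' where "es = e # es'" by (cases es) auto
    with * show "x \<in> ?B" by auto
  next
    fix x assume "x \<in> ?B"
    then obtain e es where "x = ?f w e @ concat (map2 ?f ws es)" "e \<le> m" "length es = length ws"
        "set es \<subseteq> {0..m}"
      by auto
    then show "x \<in> ?A" by (intro CollectI exI[of _ "e # es"]) auto
  qed
  then show ?case
    unfolding split by (auto simp: outputs_append outputs_repeat_word Cons.IH conc_def)
qed

text \<open>
  A layer in which nothing is taken contributes the empty word, which is why products of
  fewer than \<open>m\<close> factors are obtained as well.
\<close>

lemma outputs_membership_script:
  "outputs 0 (membership_script ws m) j = (if j = 0
     then {concat hs | hs. length hs \<le> m \<and> set hs \<subseteq> set ws} else {})"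
proof (induction m arbitrary: j)
  case 0
  show ?case by (auto simp: membership_script_def)
next
  case (Suc m)
  have split: "membership_script ws (Suc m) =
      (concat (map (mark_word Sep) ws) @ [Eps]) @ membership_script ws m"
    by (simp add: membership_script_def)
  have "{concat hs | hs. length hs \<le> Suc m \<and> set hs \<subseteq> set ws} =
     {u @ v | u v. u \<in> insert [] (set ws) \<and> (\<exists>hs. v = concat hs \<and> length hs \<le> m \<and> set hs \<subseteq> set ws)}"
    (is "?A = ?B")
  proof (intro subset_antisym subsetI)
    fix x assume "x \<in> ?A"
    then obtain hs where *: "x = concat hs" "length hs \<le> Suc m" "set hs \<subseteq> set ws" by auto
    show "x \<in> ?B"
    proof (cases hs)
      case Nil
      with * show ?thesis by (auto intro: exI[of _ "[]"])
    next
      case (Cons h hs')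
      with * show ?thesis by auto
    qed
  next
    fix x assume "x \<in> ?B"
    then obtain u hs where *: "x = u @ concat hs" "u \<in> insert [] (set ws)" "length hs \<le> m" "set hs \<subseteq> set ws"
      by auto
    show "x \<in> ?A"
    proof (cases "u \<in> set ws")
      case True
      with * show ?thesis by (intro CollectI exI[of _ "u # hs"]) auto
    next
      case False
      with * show ?thesis by (intro CollectI exI[of _ hs]) auto
    qed
  qed
  then show ?case
    unfolding split
    by (subst outputs_append) (auto simp: outputs_layer Suc.IH conc_def simp del: append_assoc)
qed

section \<open>Paths in the unrolled graph\<close>

lemma set_unrolled_edges:
  "e \<in> set (unrolled_edges p xs) \<longleftrightarrow>
     (\<exists>q<length xs. \<exists>t\<in>set (moves_in templates (xs ! q)). e = edge_at (p + q) t)"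
proof (induction xs arbitrary: p)
  case Nil
  show ?case by simp
next
  case (Cons x xs)
  have "(\<exists>q<length (x # xs). \<exists>t\<in>set (moves_in templates ((x # xs) ! q)). e = edge_at (p + q) t) \<longleftrightarrow>
     (\<exists>t\<in>set (moves_in templates x). e = edge_at p t) \<or>
     (\<exists>q<length xs. \<exists>t\<in>set (moves_in templates (xs ! q)). e = edge_at (Suc p + q) t)"
    by (simp only: list.size(4) add_Suc_right add_0_right Ex_less_Suc2 nth_Cons_0 nth_Cons_Suc add_Suc)
  then show ?case using Cons.IH by auto
qed

abbreviation unrolled_digraph :: "symbol list \<Rightarrow> (nat, edge) pre_digraph" where
  "unrolled_digraph xs \<equiv> labelled_graph (3 * length xs + 3) (unrolled_edges 0 xs)"

lemma unrolled_edgeE: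
  assumes "e \<in> set (unrolled_edges 0 xs)"
  obtains q i l j where "q < length xs" "(i, l, j) \<in> set (moves_in templates (xs ! q))"
    "i < 3" "j < 3" "e = (3 * q + i, l, 3 * Suc q + j)"
  using assms moves_bound by (fastforce simp: set_unrolled_edges)

lemma labelled_graph_cas:
  "pre_digraph.cas (labelled_graph n es) u [] v \<longleftrightarrow> u = v"
  "pre_digraph.cas (labelled_graph n es) u (e # p) v \<longleftrightarrow>
     fst e = u \<and> pre_digraph.cas (labelled_graph n es) (snd (snd e)) p v"
  by (simp_all add: pre_digraph.cas.simps labelled_graph_def)

text \<open>
  Each edge leads from a layer to the next one, so the number of the vertex strictly increases along
  a path.
\<close>

lemma unrolled_no_cycle: "\<not> pre_digraph.cycle (unrolled_digraph xs) p"
proof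
  assume "pre_digraph.cycle (unrolled_digraph xs) p"
  then obtain u where u: "set p \<subseteq> set (unrolled_edges 0 xs)"
      "pre_digraph.cas (unrolled_digraph xs) u p u" "p \<noteq> []"
    by (auto simp: pre_digraph.cycle_def pre_digraph.awalk_def labelled_graph_def)
  have "u \<le> v \<and> (p \<noteq> [] \<longrightarrow> u < v)"
    if "set p \<subseteq> set (unrolled_edges 0 xs)" "pre_digraph.cas (unrolled_digraph xs) u p v" for u v
    using that
  proof (induction p arbitrary: u)
    case Nil
    then show ?case by (simp add: labelled_graph_cas)
  next
    case (Cons e p)
    then have e: "e \<in> set (unrolled_edges 0 xs)" by simp
    have "fst e < snd (snd e)" by (rule unrolled_edgeE[OF e]) auto
    then show ?case using Cons by (fastforce simp: labelled_graph_cas)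
  qed
  from this[OF u(1,2)] u(3) show False by simp
qed

lemma edge_label_simp: "edge_label (u, l, v) = l"
  by (simp add: edge_label_def)

lemma map_filter_Cons_spell:
  "List.map_filter edge_label (e # p) = spell (edge_label e) (List.map_filter edge_label p)"
  by (cases "edge_label e") (auto simp: List.map_filter_def)

text \<open>
  A vertex determines its position and state, as states are smaller than \<open>3\<close>; so the
  path can be read as a run, edge by edge.
\<close>

lemma walk_outputs:
  assumes "xs = us @ ys" "pre_digraph.cas (unrolled_digraph xs) (3 * length us + i) p (3 * length xs)"
    "set p \<subseteq> set (unrolled_edges 0 xs)" "i < 3"
  shows "List.map_filter edge_label p \<in> outputs i ys 0"
  using assms
proof (induction p arbitrary: us ys i)
  case Nil
  then have "3 * length us + i = 3 * (length us + length ys)"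
    by (simp add: labelled_graph_cas)
  then have "ys = []" "i = 0" using Nil.prems(4) by auto
  then show ?case by (simp add: List.map_filter_def)
next
  case (Cons e p)
  then have e: "e \<in> set (unrolled_edges 0 xs)" by simp
  then obtain q i' l j where q: "q < length xs" "(i', l, j) \<in> set (moves_in templates (xs ! q))"
    "i' < 3" "j < 3" "e = (3 * q + i', l, 3 * Suc q + j)"
    by (rule unrolled_edgeE)
  have walk: "3 * q + i' = 3 * length us + i"
    "pre_digraph.cas (unrolled_digraph xs) (3 * Suc q + j) p (3 * length xs)"
    using Cons.prems(2) q(5) by (simp_all add: labelled_graph_cas)
  \<comment> \<open>Division of the vertex number by 3 recovers position and state.\<close>
  from walk(1) q(3) Cons.prems(4) have "q = length us" "i' = i" by presburger+
  with q Cons.prems(1) obtain y ys' where ys: "ys = y # ys'" "xs ! q = y"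
    by (cases ys) auto
  have "List.map_filter edge_label p \<in> outputs j ys' 0"
    using Cons.prems walk(2) q(4) ys \<open>q = length us\<close> by (intro Cons.IH[of "us @ [y]"]) auto
  then show ?case
    unfolding ys(1) outputs_Cons_iff using q(2) q(5) ys(2) \<open>i' = i\<close>
    by (auto simp: map_filter_Cons_spell edge_label_simp simp del: map_filter_simps)
qed

lemma outputs_walk:
  assumes "xs = us @ ys" "w \<in> outputs i ys 0"
  shows "\<exists>p. pre_digraph.cas (unrolled_digraph xs) (3 * length us + i) p (3 * length xs) \<and>
     set p \<subseteq> set (unrolled_edges 0 xs) \<and> List.map_filter edge_label p = w"
  using assms
proof (induction ys arbitrary: us i w)
  case Nil
  then show ?case
    by (intro exI[of _ "[]"]) (auto simp: labelled_graph_cas List.map_filter_def split: if_splits)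
next
  case (Cons y ys)
  then obtain l k v where v: "w = spell l v" "(i, l, k) \<in> set (moves_in templates y)" "v \<in> outputs k ys 0"
    unfolding outputs_Cons_iff by blast
  have "xs = (us @ [y]) @ ys" using Cons.prems by simp
  from Cons.IH[OF this v(3)] obtain p where p:
    "pre_digraph.cas (unrolled_digraph xs) (3 * Suc (length us) + k) p (3 * length xs)"
    "set p \<subseteq> set (unrolled_edges 0 xs)" "List.map_filter edge_label p = v"
    by auto
  let ?e = "edge_at (length us) (i, l, k)"
  have "?e \<in> set (unrolled_edges 0 xs)"
    unfolding set_unrolled_edges
    using v(2) Cons.prems(1) by (intro exI[of _ "length us"] conjI bexI[of _ "(i, l, k)"]) auto
  then show ?case
    using p v(1) by (intro exI[of _ "?e # p"])
      (auto simp: labelled_graph_cas map_filter_Cons_spell edge_label_simp simp del: map_filter_simps)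
qed

lemma positive_unrolled_graph:
  "positive_AGWP G X (unrolled_graph xs g) \<longleftrightarrow>
     (\<exists>w\<in>outputs 0 xs 0. word_val G X w = word_val G X g)"
proof -
  have "(\<exists>p. pre_digraph.awalk (unrolled_digraph xs) 0 p (3 * length xs) \<and>
        List.map_filter edge_label p = w) \<longleftrightarrow> w \<in> outputs 0 xs 0" for w
    using walk_outputs[of xs "[]" xs 0] outputs_walk[of xs "[]" xs w 0]
    by (auto simp: pre_digraph.awalk_def labelled_graph_def)
  then show ?thesis unfolding unrolled_graph_def positive_AGWP.simps by metis
qed

lemma instance_unrolled_graph:
  assumes "set xs \<subseteq> script_symbols X" "g \<in> words X"
  shows "instance_AGWP X (unrolled_graph xs g)"
proof -
  let ?D = "unrolled_digraph xs"
  have edge: "fst e < 3 * length xs + 3 \<and> snd (snd e) < 3 * length xs + 3 \<and>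
      set_option (edge_label e) \<subseteq> {..<length X}"
    if "e \<in> set (unrolled_edges 0 xs)" for e
  proof -
    obtain q i l j where q: "q < length xs" "(i, l, j) \<in> set (moves_in templates (xs ! q))"
      "i < 3" "j < 3" "e = (3 * q + i, l, 3 * Suc q + j)"
      using \<open>e \<in> set (unrolled_edges 0 xs)\<close> by (rule unrolled_edgeE)
    have "xs ! q \<in> script_symbols X" using q(1) assms(1) by auto
    then have "set_option l \<subseteq> {..<length X}"
      using q(2) by (auto simp: script_symbols_def moves)
    then show ?thesis using q by (auto simp: edge_label_def)
  qed
  have "fin_digraph ?D"
    by unfold_locales (use edge in \<open>auto simp: labelled_graph_def\<close>)
  then show ?thesis
    using edge assms(2) unrolled_no_cycle[of xs]
    by (auto simp: unrolled_graph_def labelled_graph_def)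
qed

section \<open>Values of words and positive instances\<close>

lemma (in monoid) word_val_closed:
  assumes "set X \<subseteq> carrier G" "w \<in> words X"
  shows "word_val G X w \<in> carrier G"
  unfolding word_val_def using assms by (intro monoid_prod_closed) (auto simp: words_def)

lemma (in monoid) word_val_append:
  assumes "set X \<subseteq> carrier G" "v \<in> words X" "w \<in> words X"
  shows "word_val G X (v @ w) = word_val G X v \<otimes> word_val G X w"
  unfolding word_val_def map_append using assms
  by (intro monoid_prod_append) (auto simp: words_def)

lemma word_val_Nil: "word_val G X [] = \<one>\<^bsub>G\<^esub>"
  by (simp add: word_val_def monoid_prod_def)

lemma concat_words: "set ws \<subseteq> words X \<Longrightarrow> concat ws \<in> words X"
  by (induction ws) (auto simp: words_def)

lemma (in monoid) word_val_concat:
  assumes "set X \<subseteq> carrier G" "set ws \<subseteq> words X"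
  shows "word_val G X (concat ws) = monoid_prod G (map (word_val G X) ws)"
  using assms(2)
proof (induction ws)
  case Nil
  show ?case by (simp add: word_val_Nil monoid_prod_def)
next
  case (Cons w ws)
  then show ?case
    using word_val_append[OF assms(1), of w "concat ws"] concat_words[of ws X]
    by (simp add: monoid_prod_def)
qed

lemma (in monoid) word_val_power:
  assumes "set X \<subseteq> carrier G" "w \<in> words X"
  shows "word_val G X (concat (replicate e w)) = word_val G X w [^] e"
proof (induction e)
  case 0
  show ?case by (simp add: word_val_Nil)
next
  case (Suc e)
  have "word_val G X (concat (replicate (Suc e) w)) = word_val G X w \<otimes> word_val G X w [^] e"
    using Suc word_val_append[OF assms, of "concat (replicate e w)"]
      concat_words[of "replicate e w" X] assms(2) by (simp add: set_replicate_conv_if)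
  then show ?case
    using nat_pow_Suc2[OF word_val_closed[OF assms]] by simp
qed

lemma (in monoid) word_val_knapsack:
  assumes "set X \<subseteq> carrier G" "set ws \<subseteq> words X" "length es = length ws"
  shows "word_val G X (concat (map2 (\<lambda>w e. concat (replicate e w)) ws es)) =
     monoid_prod G (map2 (\<lambda>h e. word_val G X h [^] e) ws es)"
proof -
  have "set (map2 (\<lambda>w e. concat (replicate e w)) ws es) \<subseteq> words X"
    using assms(2) concat_words[of "replicate _ _" X]
    by (auto simp: set_replicate_conv_if dest!: set_zip_leftD)
  then have "word_val G X (concat (map2 (\<lambda>w e. concat (replicate e w)) ws es)) =
     monoid_prod G (map (word_val G X) (map2 (\<lambda>w e. concat (replicate e w)) ws es))"
    by (intro word_val_concat assms(1))
  also have "map (word_val G X) (map2 (\<lambda>w e. concat (replicate e w)) ws es) =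
      map2 (\<lambda>h e. word_val G X h [^] e) ws es"
    using assms word_val_power[OF assms(1)] by (auto dest: set_zip_leftD)
  finally show ?thesis .
qed

lemma positive_SSP_iff: "positive_SSP G X (gs, g) \<longleftrightarrow> positive_BKP G X (gs, g, 1)"
proof -
  have "{0, 1} = {0..1::nat}" by auto
  then show ?thesis by simp
qed

text \<open>The exponent of \<open>g\<^sub>j\<close> is the number of its copies that are taken.\<close>

lemma (in monoid) positive_BKP_iff:
  assumes "set X \<subseteq> carrier G" "set gs \<subseteq> words X"
  shows "positive_BKP G X (gs, g, m) \<longleftrightarrow> positive_AGWP G X (unrolled_graph (knapsack_script gs m) g)"
proof -
  have "word_val G X g = monoid_prod G (map2 (\<lambda>h e. word_val G X h [^] e) gs es) \<longleftrightarrow>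
      word_val G X (concat (map2 (\<lambda>w e. concat (replicate e w)) gs es)) = word_val G X g"
    if "length es = length gs" for es
    using word_val_knapsack[OF assms that] by auto
  then have "positive_BKP G X (gs, g, m) \<longleftrightarrow>
    (\<exists>es. length es = length gs \<and> set es \<subseteq> {0..m} \<and>
       word_val G X (concat (map2 (\<lambda>w e. concat (replicate e w)) gs es)) = word_val G X g)"
    unfolding positive_BKP.simps by (intro ex_cong1) (simp cong: conj_cong)
  then show ?thesis
    unfolding positive_unrolled_graph outputs_knapsack_script by (simp only: if_True refl) blast
qed

lemma (in monoid) positive_BSMP_iff:
  assumes "set X \<subseteq> carrier G" "set gs \<subseteq> words X"
  shows "positive_BSMP G X (gs, g, m) \<longleftrightarrow> positive_AGWP G X (unrolled_graph (membership_script gs m) g)"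
proof -
  have "word_val G X (concat hs) = monoid_prod G (map (word_val G X) hs)" if "set hs \<subseteq> set gs" for hs
    using that assms by (intro word_val_concat) auto
  then have "positive_BSMP G X (gs, g, m) \<longleftrightarrow>
    (\<exists>hs. length hs \<le> m \<and> set hs \<subseteq> set gs \<and> word_val G X (concat hs) = word_val G X g)"
    unfolding positive_BSMP.simps by (intro ex_cong1) (auto cong: conj_cong)
  then show ?thesis
    unfolding positive_unrolled_graph outputs_membership_script by (simp only: if_True refl) blast
qed

section \<open>An assembly language for five-tape machines\<close>

text \<open>
  The instruction \<open>Write i j f d\<close> writes on tape \<open>i\<close> the image under \<open>f\<close> of the symbol scanned on
  tape \<open>j\<close> and then moves head \<open>i\<close>; \<open>Unless i b n\<close> skips the next \<open>n\<close> instructions if the symbol on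
  tape \<open>i\<close> does not satisfy \<open>b\<close>; \<open>Back n\<close> jumps back by \<open>n\<close> instructions. All jumps are relative, so
  that a program behaves in the same way wherever it occurs inside a larger one.
\<close>

datatype instr =
    Write nat nat "symbol \<Rightarrow> symbol" direction
  | Unless nat "symbol \<Rightarrow> bool" nat
  | Back nat

text \<open>
  Jumps are capped at the length \<open>l\<close> of the program, the halting state, so that the set of states is
  closed under transitions for every program.
\<close>

fun perform :: "nat \<Rightarrow> nat \<Rightarrow> symbol list \<Rightarrow> instr \<Rightarrow> nat \<times> (symbol \<times> direction) list" where
  "perform l q rs (Write i j f d) = (Suc q, (map (\<lambda>s. (s, Stay)) rs)[i := (f (rs ! j), d)])"
| "perform l q rs (Unless i b n) =
     (if b (rs ! i) then Suc q else min l (Suc q + n), map (\<lambda>s. (s, Stay)) rs)"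
| "perform l q rs (Back n) = (q - n, map (\<lambda>s. (s, Stay)) rs)"

definition machine :: "symbol set \<Rightarrow> instr list \<Rightarrow> turing_machine" where
  "machine A P = \<lparr>tm_states = {..length P}, tm_start = 0, tm_alphabet = A, tm_tapes = 5,
     tm_delta = (\<lambda>q rs. if q < length P then Some (perform (length P) q rs (P ! q)) else None)\<rparr>"

fun instr_ok :: "symbol set \<Rightarrow> instr \<Rightarrow> bool" where
  "instr_ok A (Write i j f d) \<longleftrightarrow> j < 5 \<and> (\<forall>a\<in>A. f a \<in> A)"
| "instr_ok A (Unless i b n) \<longleftrightarrow> True"
| "instr_ok A (Back n) \<longleftrightarrow> True"

lemma wf_machine:
  assumes "finite A" "Blank \<in> A" "\<forall>c\<in>set P. instr_ok A c"
  shows "wf_tm (machine A P)"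
proof -
  have key: "q' \<le> length P \<and> length as = 5 \<and> fst ` set as \<subseteq> A"
    if q: "q < length P" and rs: "set rs \<subseteq> A" "length rs = 5"
      and eq: "perform (length P) q rs (P ! q) = (q', as)" for q rs q' as
  proof -
    have ok: "instr_ok A (P ! q)" using assms(3) q by auto
    have stay: "fst ` set (map (\<lambda>s. (s, Stay)) rs) \<subseteq> A" using rs by auto
    show ?thesis
    proof (cases "P ! q")
      case (Write i j f d)
      have j: "j < 5" "\<forall>a\<in>A. f a \<in> A" using ok unfolding Write by simp_all
      then have "rs ! j \<in> A" using rs nth_mem[of j rs] by (simp add: subset_iff)
      then have fj: "f (rs ! j) \<in> A" using j(2) by simp
      have "fst ` set ((map (\<lambda>s. (s, Stay)) rs)[i := (f (rs ! j), d)]) \<subseteq> A"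
      proof (rule image_subsetI)
        fix x assume x: "x \<in> set ((map (\<lambda>s. (s, Stay)) rs)[i := (f (rs ! j), d)])"
        have "x = (f (rs ! j), d) \<or> x \<in> set (map (\<lambda>s. (s, Stay)) rs)"
          using subsetD[OF set_update_subset_insert x] by simp
        then show "fst x \<in> A" using stay fj by auto
      qed
      then show ?thesis using eq q rs Write by auto
    next
      case (Unless i b n)
      then show ?thesis using eq q rs stay by auto
    next
      case (Back n)
      then show ?thesis using eq q rs stay by auto
    qed
  qed
  show ?thesis
    unfolding wf_tm_def machine_def turing_machine.simps
  proof (intro conjI ballI impI allI)
    fix q rs q' as
    assume "rs \<in> lists A" "length rs = 5"
      and *: "(if q < length P then Some (perform (length P) q rs (P ! q)) else None) = Some (q', as)"
    then have "q' \<le> length P \<and> length as = 5 \<and> fst ` set as \<subseteq> A"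
      by (intro key[of q rs q' as]) (auto split: if_splits)
    then show "q' \<in> {..length P}" "length as = 5" "fst ` set as \<subseteq> A" by auto
  qed (use assms in auto)
qed

text \<open>
  Specifications speak of the tapes as a function of their index: function updates then record
  which tapes a program changes, and everything else is known to stay as it is.
\<close>

definition tape_list :: "(nat \<Rightarrow> tape) \<Rightarrow> tape list" where
  "tape_list \<sigma> = map \<sigma> [0..<5]"

text \<open>
  The quantification over the surrounding program \<open>us\<close>, \<open>vs\<close> is what makes the judgement
  compositional: the parts of a sequence or of a loop body are run inside the whole.
\<close>

definition runs :: "instr list \<Rightarrow> (nat \<Rightarrow> tape) \<Rightarrow> nat \<Rightarrow> (nat \<Rightarrow> tape) \<Rightarrow> bool" where
  "runs P \<sigma> n \<tau> \<longleftrightarrow> (\<forall>A us vs. \<exists>n'\<le>n.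
     (tm_step (machine A (us @ P @ vs)) ^^ n') (length us, tape_list \<sigma>) =
       (length us + length P, tape_list \<tau>))"

lemma tape_act_scanned: "tape_act (scanned t, d) t = (fst t, snd t + offset d)"
  by (simp add: tape_act_def scanned_def)

lemma stay_all: "map2 tape_act (map (\<lambda>s. (s, Stay)) (map scanned ts)) ts = ts"
  by (induction ts) (auto simp: tape_act_scanned)

lemma tape_list_upd:
  assumes "i < 5"
  shows "map2 tape_act ((map (\<lambda>s. (s, Stay)) (map scanned (tape_list \<sigma>)))[i := a]) (tape_list \<sigma>)
           = tape_list (\<sigma>(i := tape_act a (\<sigma> i)))"
  using assms
  by (intro nth_equalityI) (auto simp: tape_list_def nth_list_update tape_act_scanned)

lemma scanned_tape_list: "i < 5 \<Longrightarrow> map scanned (tape_list \<sigma>) ! i = scanned (\<sigma> i)"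
  by (simp add: tape_list_def)

lemma step_machine:
  "tm_step (machine A (us @ c # vs)) (length us, ts) =
     (case perform (length us + Suc (length vs)) (length us) (map scanned ts) c of
        (q, as) \<Rightarrow> (q, map2 tape_act as ts))"
  by (simp add: tm_step_def machine_def)

lemma runs_mono: "runs P \<sigma> m \<tau> \<Longrightarrow> m \<le> n \<Longrightarrow> runs P \<sigma> n \<tau>"
  unfolding runs_def by (meson order_trans)

lemma runs_conv: "runs P \<sigma> m \<tau> \<Longrightarrow> m \<le> n \<Longrightarrow> \<tau> = \<rho> \<Longrightarrow> runs P \<sigma> n \<rho>"
  using runs_mono by blast

lemma runs_Nil: "runs [] \<sigma> n \<sigma>"
  unfolding runs_def by (auto intro: exI[of _ 0])

lemma runs_seq:
  assumes "runs P \<sigma> m \<tau>" "runs Q \<tau> n \<rho>"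
  shows "runs (P @ Q) \<sigma> (m + n) \<rho>"
  unfolding runs_def
proof (intro allI)
  fix A us vs
  let ?step = "tm_step (machine A (us @ (P @ Q) @ vs))"
  obtain m' where m: "m' \<le> m"
    "(?step ^^ m') (length us, tape_list \<sigma>) = (length us + length P, tape_list \<tau>)"
    using assms(1)[unfolded runs_def, rule_format, of A us "Q @ vs"] by auto
  obtain n' where n: "n' \<le> n"
    "(?step ^^ n') (length us + length P, tape_list \<tau>)
       = (length us + length (P @ Q), tape_list \<rho>)"
    using assms(2)[unfolded runs_def, rule_format, of A "us @ P" vs] by (auto simp: add.assoc)
  have "(?step ^^ (n' + m')) (length us, tape_list \<sigma>) = (length us + length (P @ Q), tape_list \<rho>)"
    using m n by (simp only: funpow_add o_apply)
  then show "\<exists>k\<le>m + n. (?step ^^ k) (length us, tape_list \<sigma>) =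
      (length us + length (P @ Q), tape_list \<rho>)"
    using m n by (intro exI[of _ "n' + m'"]) auto
qed

lemma runs_Write:
  assumes "i < 5" "j < 5"
  shows "runs [Write i j f d] \<sigma> 1 (\<sigma>(i := tape_act (f (scanned (\<sigma> j)), d) (\<sigma> i)))"
  unfolding runs_def
proof (intro allI)
  fix A us vs
  let ?c = "Write i j f d"
  have "tm_step (machine A (us @ [?c] @ vs)) (length us, tape_list \<sigma>) =
    (Suc (length us), tape_list (\<sigma>(i := tape_act (f (scanned (\<sigma> j)), d) (\<sigma> i))))"
    using assms step_machine[of A us ?c vs "tape_list \<sigma>"]
    by (simp add: tape_list_upd scanned_tape_list del: map_map)
  then show "\<exists>k\<le>1. (tm_step (machine A (us @ [?c] @ vs)) ^^ k) (length us, tape_list \<sigma>) =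
      (length us + length [?c], tape_list (\<sigma>(i := tape_act (f (scanned (\<sigma> j)), d) (\<sigma> i))))"
    by (intro exI[of _ 1]) auto
qed

definition "when" :: "nat \<Rightarrow> (symbol \<Rightarrow> bool) \<Rightarrow> instr list \<Rightarrow> instr list" where
  "when i b P = Unless i b (length P) # P"

definition while :: "nat \<Rightarrow> (symbol \<Rightarrow> bool) \<Rightarrow> instr list \<Rightarrow> instr list" where
  "while i b P = Unless i b (Suc (length P)) # P @ [Back (Suc (length P))]"

lemma step_Unless:
  assumes "i < 5"
  shows "tm_step (machine A (us @ Unless i b n # vs)) (length us, tape_list \<sigma>) =
    (if b (scanned (\<sigma> i)) then Suc (length us)
     else min (length us + Suc (length vs)) (Suc (length us) + n), tape_list \<sigma>)"
  using assms by (simp add: step_machine scanned_tape_list stay_all del: map_map)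

lemma step_Back:
  "tm_step (machine A (us @ Back n # vs)) (length us, tape_list \<sigma>) = (length us - n, tape_list \<sigma>)"
  by (simp add: step_machine stay_all del: map_map)

lemma runs_when_False:
  assumes "\<not> b (scanned (\<sigma> i))" "i < 5"
  shows "runs (when i b P) \<sigma> 1 \<sigma>"
  unfolding runs_def
proof (intro allI)
  fix A us vs
  show "\<exists>k\<le>1. (tm_step (machine A (us @ when i b P @ vs)) ^^ k) (length us, tape_list \<sigma>) =
      (length us + length (when i b P), tape_list \<sigma>)"
    using assms by (intro exI[of _ 1]) (auto simp: when_def step_Unless)
qed

lemma runs_when_True:
  assumes "b (scanned (\<sigma> i))" "i < 5" "runs P \<sigma> n \<tau>"
  shows "runs (when i b P) \<sigma> (Suc n) \<tau>"
  unfolding runs_def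
proof (intro allI)
  fix A us vs
  let ?step = "tm_step (machine A (us @ when i b P @ vs))"
  obtain n' where n: "n' \<le> n"
    "(?step ^^ n') (Suc (length us), tape_list \<sigma>) = (length us + length (when i b P), tape_list \<tau>)"
    using assms(3)[unfolded runs_def, rule_format, of A "us @ [Unless i b (length P)]" vs]
    by (auto simp: when_def)
  have "?step (length us, tape_list \<sigma>) = (Suc (length us), tape_list \<sigma>)"
    using assms by (simp add: when_def step_Unless)
  then have "(?step ^^ Suc n') (length us, tape_list \<sigma>) =
      (length us + length (when i b P), tape_list \<tau>)"
    using n by (simp add: funpow_swap1)
  then show "\<exists>k\<le>Suc n. (?step ^^ k) (length us, tape_list \<sigma>) =
      (length us + length (when i b P), tape_list \<tau>)"
    using n(1) by (intro exI[of _ "Suc n'"]) auto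
qed

lemma runs_while_False:
  assumes "\<not> b (scanned (\<sigma> i))" "i < 5"
  shows "runs (while i b P) \<sigma> 1 \<sigma>"
  unfolding runs_def
proof (intro allI)
  fix A us vs
  show "\<exists>k\<le>1. (tm_step (machine A (us @ while i b P @ vs)) ^^ k) (length us, tape_list \<sigma>) =
      (length us + length (while i b P), tape_list \<sigma>)"
    using assms by (intro exI[of _ 1]) (auto simp: while_def step_Unless)
qed

text \<open>Each iteration costs two steps besides the body: the test and the jump back.\<close>

lemma runs_while_True:
  assumes "b (scanned (\<sigma> i))" "i < 5" "runs P \<sigma> m \<tau>" "runs (while i b P) \<tau> n \<rho>"
  shows "runs (while i b P) \<sigma> (m + 2 + n) \<rho>"
  unfolding runs_def
proof (intro allI)
  fix A us vs
  let ?W = "while i b P"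
  let ?step = "tm_step (machine A (us @ ?W @ vs))"
  have 1: "?step (length us, tape_list \<sigma>) = (Suc (length us), tape_list \<sigma>)"
    using assms by (simp add: while_def step_Unless)
  obtain m' where m: "m' \<le> m"
    "(?step ^^ m') (Suc (length us), tape_list \<sigma>) = (Suc (length us) + length P, tape_list \<tau>)"
    using assms(3)[unfolded runs_def, rule_format,
        of A "us @ [Unless i b (Suc (length P))]" "[Back (Suc (length P))] @ vs"]
    by (auto simp: while_def)
  have 2: "?step (Suc (length us) + length P, tape_list \<tau>) = (length us, tape_list \<tau>)"
    using step_Back[of A "us @ Unless i b (Suc (length P)) # P" "Suc (length P)" vs \<tau>]
    by (simp add: while_def)
  obtain n' where n: "n' \<le> n"
    "(?step ^^ n') (length us, tape_list \<tau>) = (length us + length ?W, tape_list \<rho>)"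
    using assms(4)[unfolded runs_def, rule_format, of A us vs] by auto
  have "(?step ^^ (n' + (1 + (m' + 1)))) (length us, tape_list \<sigma>) =
      (length us + length ?W, tape_list \<rho>)"
    unfolding funpow_add o_apply using 1 2 m n by (simp del: add_Suc)
  then show "\<exists>k\<le>m + 2 + n. (?step ^^ k) (length us, tape_list \<sigma>) =
      (length us + length ?W, tape_list \<rho>)"
    using m n by (intro exI[of _ "n' + (1 + (m' + 1))"]) auto
qed

lemma runs_computes:
  assumes "runs P ((\<lambda>_. (written [], 0))(0 := (written x, 0))) n \<tau>" "fst (\<tau> 1) = written y"
  shows "tm_computes_within (machine A P) x y n"
proof -
  let ?\<sigma> = "(\<lambda>_. (written [], 0))(0 := (written x, 0))"
  have init: "tm_init (machine A P) x = (0, tape_list ?\<sigma>)"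
    by (simp add: tm_init_def machine_def tape_list_def eval_nat_numeral upt_rec)
  obtain k where "k \<le> n" "(tm_step (machine A P) ^^ k) (0, tape_list ?\<sigma>) = (length P, tape_list \<tau>)"
    using assms(1)[unfolded runs_def, rule_format, of A "[]" "[]"] by auto
  then show ?thesis unfolding tm_computes_within_def
    using assms(2) by (intro exI[of _ k])
      (simp add: init, simp add: tm_halted_def machine_def tape_list_def)
qed

section \<open>Moving heads and copying symbols\<close>

text \<open>
  A tape whose head is on the first symbol of \<open>vs\<close>, with \<open>us\<close> written to its left. If \<open>vs\<close> is empty,
  the head is on the blank behind the content, ready to append.
\<close>

definition zipper :: "symbol list \<Rightarrow> symbol list \<Rightarrow> tape" where
  "zipper us vs = (written (us @ vs), int (length us))"

abbreviation end_of :: "symbol list \<Rightarrow> tape" where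
  "end_of us \<equiv> zipper us []"

lemma fst_zipper [simp]: "fst (zipper us vs) = written (us @ vs)"
  by (simp add: zipper_def)

lemma scanned_zipper [simp]: "scanned (zipper us vs) = (case vs of [] \<Rightarrow> Blank | v # _ \<Rightarrow> v)"
  by (auto simp: zipper_def scanned_def written_def nth_append split: list.splits)

lemma scanned_before_start [simp]: "scanned (written us, -1) = Blank"
  by (simp add: scanned_def written_def)

lemma written_append: "(written us)(int (length us) := a) = written (us @ [a])"
  by (auto simp: written_def fun_eq_iff nth_append nat_eq_iff)

definition move :: "nat \<Rightarrow> direction \<Rightarrow> instr list" where
  "move i d = [Write i i (\<lambda>s. s) d]"

definition put :: "nat \<Rightarrow> symbol \<Rightarrow> instr list" where
  "put i a = [Write i i (\<lambda>_. a) Go_right]"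

lemma runs_move: "i < 5 \<Longrightarrow> runs (move i d) \<sigma> 1 (\<sigma>(i := (fst (\<sigma> i), snd (\<sigma> i) + offset d)))"
  using runs_Write[of i i "\<lambda>s. s" d \<sigma>] by (simp add: move_def tape_act_scanned)

lemma runs_right:
  assumes "\<sigma> i = zipper us (v # vs)" "i < 5"
  shows "runs (move i Go_right) \<sigma> 1 (\<sigma>(i := zipper (us @ [v]) vs))"
  using runs_move[of i Go_right \<sigma>] assms by (simp add: zipper_def add.commute)

lemma runs_left:
  assumes "\<sigma> i = zipper (us @ [v]) vs" "i < 5"
  shows "runs (move i Go_left) \<sigma> 1 (\<sigma>(i := zipper us (v # vs)))"
  using runs_move[of i Go_left \<sigma>] assms by (simp add: zipper_def)

lemma runs_left_off:
  assumes "\<sigma> i = zipper [] vs" "i < 5"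
  shows "runs (move i Go_left) \<sigma> 1 (\<sigma>(i := (written vs, -1)))"
  using runs_move[of i Go_left \<sigma>] assms by (simp add: zipper_def)

lemma runs_right_on:
  assumes "\<sigma> i = (written vs, -1)" "i < 5"
  shows "runs (move i Go_right) \<sigma> 1 (\<sigma>(i := zipper [] vs))"
  using runs_move[of i Go_right \<sigma>] assms by (simp add: zipper_def add.commute)

lemma tape_act_end_of: "tape_act (a, Go_right) (end_of us) = end_of (us @ [a])"
  by (simp add: tape_act_def zipper_def written_append)

lemma runs_append:
  assumes "\<sigma> i = end_of us" "i < 5" "j < 5" "f (scanned (\<sigma> j)) = a"
  shows "runs [Write i j f Go_right] \<sigma> 1 (\<sigma>(i := end_of (us @ [a])))"
  using runs_Write[of i j f Go_right \<sigma>] assms by (simp add: tape_act_end_of)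

lemma runs_put:
  assumes "\<sigma> i = end_of us" "i < 5"
  shows "runs (put i a) \<sigma> 1 (\<sigma>(i := end_of (us @ [a])))"
  using runs_append[of \<sigma> i us i "\<lambda>_. a"] assms by (simp add: put_def)

definition puts :: "nat \<Rightarrow> symbol list \<Rightarrow> instr list" where
  "puts i ys = concat (map (put i) ys)"

lemma runs_puts:
  assumes "\<sigma> i = end_of us" "i < 5"
  shows "runs (puts i ys) \<sigma> (length ys) (\<sigma>(i := end_of (us @ ys)))"
  using assms(1)
proof (induction ys arbitrary: \<sigma> us)
  case Nil
  show ?case unfolding puts_def
    by (rule runs_conv[of _ _ 0 \<sigma>]) (use Nil in \<open>auto intro: runs_Nil\<close>)
next
  case (Cons a ys)
  let ?\<tau> = "\<sigma>(i := end_of (us @ [a]))"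
  have 1: "runs (put i a) \<sigma> 1 ?\<tau>" using Cons.prems assms(2) by (intro runs_put) auto
  have 2: "runs (puts i ys) ?\<tau> (length ys) (?\<tau>(i := end_of ((us @ [a]) @ ys)))"
    by (intro Cons.IH) auto
  have prog: "puts i (a # ys) = put i a @ puts i ys" by (simp add: puts_def)
  show ?case unfolding prog by (rule runs_conv[OF runs_seq[OF 1 2]]) auto
qed

lemma scan_right:
  assumes "\<sigma> i = zipper us (seg @ vs)" "i < 5" "\<forall>s\<in>set seg. b s"
    and stop: "\<not> b (case vs of [] \<Rightarrow> Blank | v # _ \<Rightarrow> v)"
  shows "runs (while i b (move i Go_right)) \<sigma> (3 * length seg + 1) (\<sigma>(i := zipper (us @ seg) vs))"
  using assms(1,3)
proof (induction seg arbitrary: \<sigma> us)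
  case Nil
  then have "\<sigma>(i := zipper (us @ []) vs) = \<sigma>" by auto
  then show ?case using runs_while_False[of b \<sigma> i] stop Nil assms(2) by simp
next
  case (Cons s seg)
  let ?\<tau> = "\<sigma>(i := zipper (us @ [s]) (seg @ vs))"
  have 1: "runs (move i Go_right) \<sigma> 1 ?\<tau>"
    using Cons.prems assms(2) by (intro runs_right) auto
  have 2: "runs (while i b (move i Go_right)) ?\<tau> (3 * length seg + 1)
      (?\<tau>(i := zipper ((us @ [s]) @ seg) vs))"
    using Cons.prems by (intro Cons.IH) auto
  show ?case
    by (rule runs_conv[OF runs_while_True[OF _ assms(2) 1 2]]) (use Cons.prems in auto)
qed

text \<open>
  The head starts on \<open>v\<close> and stops on the nearest symbol to its left that violates \<open>b\<close>.
\<close>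

lemma scan_left:
  assumes "\<sigma> i = zipper (us @ t # seg) (v # vs)" "i < 5" "\<forall>s\<in>set (seg @ [v]). b s" "\<not> b t"
  shows "runs (while i b (move i Go_left)) \<sigma> (3 * length seg + 4)
           (\<sigma>(i := zipper us (t # seg @ v # vs)))"
  using assms(1,3)
proof (induction seg arbitrary: \<sigma> v vs rule: rev_induct)
  case Nil
  let ?\<tau> = "\<sigma>(i := zipper us (t # v # vs))"
  have 1: "runs (move i Go_left) \<sigma> 1 ?\<tau>"
    using Nil.prems assms(2) by (intro runs_left) auto
  have 2: "runs (while i b (move i Go_left)) ?\<tau> 1 ?\<tau>"
    using assms(2,4) by (intro runs_while_False) auto
  show ?case
    by (rule runs_conv[OF runs_while_True[OF _ assms(2) 1 2]]) (use Nil.prems in auto)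
next
  case (snoc s seg)
  let ?\<tau> = "\<sigma>(i := zipper (us @ t # seg) (s # v # vs))"
  have 1: "runs (move i Go_left) \<sigma> 1 ?\<tau>"
    using snoc.prems assms(2) by (intro runs_left) auto
  have 2: "runs (while i b (move i Go_left)) ?\<tau> (3 * length seg + 4)
      (?\<tau>(i := zipper us (t # seg @ s # v # vs)))"
    using snoc.prems by (intro snoc.IH) auto
  show ?case
    by (rule runs_conv[OF runs_while_True[OF _ assms(2) 1 2]]) (use snoc.prems in auto)
qed

text \<open>
  The end of the content is recognised by the blank at position \<open>-1\<close>, so the content must be free of blanks.
\<close>

definition rewind :: "nat \<Rightarrow> instr list" where
  "rewind i = move i Go_left @ while i (\<lambda>s. s \<noteq> Blank) (move i Go_left) @ move i Go_right"

lemma runs_rewind: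
  assumes "\<sigma> i = zipper us vs" "i < 5" "Blank \<notin> set us"
  shows "runs (rewind i) \<sigma> (3 * length us + 3) (\<sigma>(i := zipper [] (us @ vs)))"
proof -
  let ?loop = "while i (\<lambda>s. s \<noteq> Blank) (move i Go_left)"
  have loop: "runs ?loop \<tau> (3 * length us + 4) (\<tau>(i := (written (us @ v # vs), -1)))"
    if "\<tau> i = zipper us (v # vs)" "Blank \<notin> set (us @ [v])" for \<tau> us v vs
    using that
  proof (induction us arbitrary: \<tau> v vs rule: rev_induct)
    case Nil
    have 1: "runs (move i Go_left) \<tau> 1 (\<tau>(i := (written (v # vs), -1)))"
      using Nil assms(2) by (intro runs_left_off) auto
    show ?case
      by (rule runs_conv[OF runs_while_True[OF _ assms(2) 1 runs_while_False]])
        (use Nil assms(2) in auto)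
  next
    case (snoc u us)
    let ?\<tau>' = "\<tau>(i := zipper us (u # v # vs))"
    have 1: "runs (move i Go_left) \<tau> 1 ?\<tau>'"
      using snoc.prems assms(2) by (intro runs_left) auto
    have 2: "runs ?loop ?\<tau>' (3 * length us + 4) (?\<tau>'(i := (written (us @ u # v # vs), -1)))"
      using snoc.prems by (intro snoc.IH) auto
    show ?case
      by (rule runs_conv[OF runs_while_True[OF _ assms(2) 1 2]]) (use snoc.prems in auto)
  qed
  let ?\<rho> = "\<sigma>(i := (written (us @ vs), -1))"
  have 1: "runs (move i Go_left @ ?loop) \<sigma> (3 * length us + 2) ?\<rho>"
  proof (cases us rule: rev_cases)
    case Nil
    have "runs (move i Go_left) \<sigma> 1 ?\<rho>"
      using runs_left_off[of \<sigma> i vs] assms Nil by simp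
    from runs_seq[OF this runs_while_False] show ?thesis using assms(2) Nil by simp
  next
    case (snoc us' u)
    have 1: "runs (move i Go_left) \<sigma> 1 (\<sigma>(i := zipper us' (u # vs)))"
      using assms snoc by (intro runs_left) auto
    show ?thesis
      by (rule runs_conv[OF runs_seq[OF 1 loop]]) (use assms snoc in auto)
  qed
  have 2: "runs (move i Go_right) ?\<rho> 1 (?\<rho>(i := zipper [] (us @ vs)))"
    using assms(2) by (intro runs_right_on) auto
  show ?thesis
    using runs_conv[OF runs_seq[OF 1 2]] by (simp add: rewind_def)
qed

definition copy_letters :: "nat \<Rightarrow> nat \<Rightarrow> instr list" where
  "copy_letters j i = while j is_letter ([Write i j (\<lambda>s. s) Go_right] @ move j Go_right)"

lemma runs_copy_letters:
  assumes "\<sigma> j = zipper us (map Letter w @ v # vs)" "\<sigma> i = end_of y"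
    and "i < 5" "j < 5" "i \<noteq> j" "\<not> is_letter v"
  shows "runs (copy_letters j i) \<sigma> (4 * length w + 1)
           (\<sigma>(j := zipper (us @ map Letter w) (v # vs), i := end_of (y @ map Letter w)))"
  using assms(1,2)
proof (induction w arbitrary: \<sigma> us y)
  case Nil
  show ?case unfolding copy_letters_def
    by (rule runs_conv[OF runs_while_False]) (use Nil assms in auto)
next
  case (Cons a w)
  let ?\<tau> = "\<sigma>(i := end_of (y @ [Letter a]))"
  let ?\<rho> = "?\<tau>(j := zipper (us @ [Letter a]) (map Letter w @ v # vs))"
  have 1: "runs [Write i j (\<lambda>s. s) Go_right] \<sigma> 1 ?\<tau>"
    using Cons.prems assms by (intro runs_append) auto
  have 2: "runs (move j Go_right) ?\<tau> 1 ?\<rho>"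
    using Cons.prems assms by (intro runs_right) auto
  have 3: "runs (copy_letters j i) ?\<rho> (4 * length w + 1) (?\<rho>
    (j := zipper ((us @ [Letter a]) @ map Letter w) (v # vs),
     i := end_of ((y @ [Letter a]) @ map Letter w)))"
    using assms by (intro Cons.IH) auto
  show ?case unfolding copy_letters_def
    by (rule runs_conv[OF runs_while_True[OF _ _ runs_seq[OF 1 2] 3[unfolded copy_letters_def]]])
      (use Cons.prems assms in auto)
qed

section \<open>Writing the script\<close>

text \<open>
  The number of repetitions is held in unary on tape 2, whose head is put back afterwards, so that
  the loop can be run again.
\<close>

definition repeat :: "instr list \<Rightarrow> instr list" where
  "repeat P = while 2 (\<lambda>s. s = Tick) (P @ move 2 Go_right) @ rewind 2"

lemma runs_repeat:
  assumes body: "\<And>\<tau> y. \<tau> 0 = t \<Longrightarrow> \<tau> 3 = end_of y \<Longrightarrow> runs P \<tau> T (\<tau>(3 := end_of (y @ blk)))"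
    and "\<sigma> 0 = t" "\<sigma> 2 = zipper [] (replicate m Tick)" "\<sigma> 3 = end_of y"
  shows "runs (repeat P) \<sigma> (m * (T + 6) + 4) (\<sigma>(3 := end_of (y @ concat (replicate m blk))))"
proof -
  let ?loop = "while 2 (\<lambda>s. s = Tick) (P @ move 2 Go_right)"
  have loop: "runs ?loop \<tau> (r * (T + 3) + 1)
      (\<tau>(2 := end_of (us @ replicate r Tick), 3 := end_of (y @ concat (replicate r blk))))"
    if "\<tau> 0 = t" "\<tau> 2 = zipper us (replicate r Tick)" "\<tau> 3 = end_of y" for \<tau> us r y
    using that
  proof (induction r arbitrary: \<tau> us y)
    case 0
    show ?case by (rule runs_conv[OF runs_while_False]) (use 0 in auto)
  next
    case (Suc r)
    let ?\<tau> = "\<tau>(3 := end_of (y @ blk))"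
    let ?\<rho> = "?\<tau>(2 := zipper (us @ [Tick]) (replicate r Tick))"
    have 1: "runs P \<tau> T ?\<tau>" using Suc.prems by (intro body) auto
    have 2: "runs (move 2 Go_right) ?\<tau> 1 ?\<rho>" using Suc.prems by (intro runs_right) auto
    have 3: "runs ?loop ?\<rho> (r * (T + 3) + 1) (?\<rho>(2 := end_of ((us @ [Tick]) @ replicate r Tick),
        3 := end_of ((y @ blk) @ concat (replicate r blk))))"
      using Suc.prems by (intro Suc.IH) auto
    show ?case
      by (rule runs_conv[OF runs_while_True[OF _ _ runs_seq[OF 1 2] 3]])
        (use Suc.prems in \<open>auto simp: fun_eq_iff\<close>)
  qed
  let ?\<tau> = "\<sigma>(2 := end_of ([] @ replicate m Tick), 3 := end_of (y @ concat (replicate m blk)))"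
  have 1: "runs ?loop \<sigma> (m * (T + 3) + 1) ?\<tau>" using assms by (intro loop) auto
  have 2: "runs (rewind 2) ?\<tau> (3 * length (replicate m Tick) + 3)
     (?\<tau>(2 := zipper [] (replicate m Tick @ [])))"
    by (intro runs_rewind) auto
  show ?thesis unfolding repeat_def
    by (rule runs_conv[OF runs_seq[OF 1 2]]) (use assms in \<open>auto simp: fun_eq_iff algebra_simps\<close>)
qed

definition copy_marked :: "symbol \<Rightarrow> instr list" where
  "copy_marked t = move 0 Go_right @ put 3 Tick @ copy_letters 0 3 @ put 3 t"

lemma runs_copy_marked:
  assumes "\<sigma> 0 = zipper us (mark_word Sep w @ vs)" "\<sigma> 3 = end_of y"
  shows "runs (copy_marked t) \<sigma> (4 * length w + 4)
    (\<sigma>(0 := zipper (us @ Tick # map Letter w) (Sep # vs), 3 := end_of (y @ mark_word t w)))"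
proof -
  let ?\<sigma>1 = "\<sigma>(0 := zipper (us @ [Tick]) (map Letter w @ Sep # vs))"
  let ?\<sigma>2 = "?\<sigma>1(3 := end_of (y @ [Tick]))"
  let ?\<sigma>3 = "?\<sigma>2(0 := zipper ((us @ [Tick]) @ map Letter w) (Sep # vs),
      3 := end_of ((y @ [Tick]) @ map Letter w))"
  have 1: "runs (move 0 Go_right) \<sigma> 1 ?\<sigma>1"
    using assms by (intro runs_right) (auto simp: mark_word_def)
  have 2: "runs (put 3 Tick) ?\<sigma>1 1 ?\<sigma>2"
    using assms by (intro runs_put) auto
  have 3: "runs (copy_letters 0 3) ?\<sigma>2 (4 * length w + 1) ?\<sigma>3"
    by (intro runs_copy_letters) auto
  have 4: "runs (put 3 t) ?\<sigma>3 1 (?\<sigma>3(3 := end_of (((y @ [Tick]) @ map Letter w) @ [t])))"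
    by (intro runs_put) auto
  show ?thesis unfolding copy_marked_def
    by (rule runs_conv[OF runs_seq[OF 1 runs_seq[OF 2 runs_seq[OF 3 4]]]])
      (auto simp: fun_eq_iff mark_word_def)
qed

definition skip_word :: "instr list" where
  "skip_word = move 0 Go_right @ while 0 is_letter (move 0 Go_right) @ move 0 Go_right"

lemma runs_skip_word:
  assumes "\<sigma> 0 = zipper us (mark_word Sep w @ vs)"
  shows "runs skip_word \<sigma> (3 * length w + 3) (\<sigma>(0 := zipper (us @ mark_word Sep w) vs))"
proof -
  let ?\<sigma>1 = "\<sigma>(0 := zipper (us @ [Tick]) (map Letter w @ Sep # vs))"
  let ?\<sigma>2 = "?\<sigma>1(0 := zipper ((us @ [Tick]) @ map Letter w) (Sep # vs))"
  have 1: "runs (move 0 Go_right) \<sigma> 1 ?\<sigma>1"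
    using assms by (intro runs_right) (auto simp: mark_word_def)
  have 2: "runs (while 0 is_letter (move 0 Go_right)) ?\<sigma>1 (3 * length (map Letter w) + 1) ?\<sigma>2"
    by (intro scan_right) auto
  have 3: "runs (move 0 Go_right) ?\<sigma>2 1 (?\<sigma>2(0 := zipper (((us @ [Tick]) @ map Letter w) @ [Sep]) vs))"
    by (intro runs_right) auto
  show ?thesis unfolding skip_word_def
    by (rule runs_conv[OF runs_seq[OF 1 runs_seq[OF 2 3]]]) (auto simp: mark_word_def)
qed

definition for_words :: "instr list \<Rightarrow> instr list" where
  "for_words P = while 0 (\<lambda>s. s = Tick) P"

text \<open>
  Covers each pass over the word list: the body handles one word and appends its contribution \<open>h w\<close>
  to the script on tape 3.
\<close>

lemma runs_for_words:
  assumes body: "\<And>\<tau> us w vs y. w \<in> set ws \<Longrightarrow> \<tau> 0 = zipper us (mark_word Sep w @ vs) \<Longrightarrow>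
      \<tau> 2 = t \<Longrightarrow> \<tau> 3 = end_of y \<Longrightarrow>
      runs P \<tau> T (\<tau>(0 := zipper (us @ mark_word Sep w) vs, 3 := end_of (y @ h w)))"
    and "\<sigma> 0 = zipper us (concat (map (mark_word Sep) ws) @ v # vs)" "v \<noteq> Tick"
      "\<sigma> 2 = t" "\<sigma> 3 = end_of y"
  shows "runs (for_words P) \<sigma> (length ws * (T + 2) + 1)
      (\<sigma>(0 := zipper (us @ concat (map (mark_word Sep) ws)) (v # vs),
         3 := end_of (y @ concat (map h ws))))"
  using assms(1,2,4,5)
proof (induction ws arbitrary: \<sigma> us y)
  case Nil
  show ?case unfolding for_words_def
    by (rule runs_conv[OF runs_while_False]) (use Nil assms(3) in auto)
next
  case (Cons w ws)
  let ?\<tau> = "\<sigma>(0 := zipper (us @ mark_word Sep w) (concat (map (mark_word Sep) ws) @ v # vs),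
     3 := end_of (y @ h w))"
  have 1: "runs P \<sigma> T ?\<tau>"
    using Cons.prems by (intro Cons.prems(1)) auto
  have 2: "runs (for_words P) ?\<tau> (length ws * (T + 2) + 1)
      (?\<tau>(0 := zipper ((us @ mark_word Sep w) @ concat (map (mark_word Sep) ws)) (v # vs),
         3 := end_of ((y @ h w) @ concat (map h ws))))"
    using Cons.prems by (intro Cons.IH) auto
  show ?case unfolding for_words_def
    by (rule runs_conv[OF runs_while_True[OF _ _ 1 2[unfolded for_words_def]]])
      (use Cons.prems in \<open>auto simp: mark_word_def[of Sep w] fun_eq_iff\<close>)
qed

text \<open>After each copy the head goes back to the \<open>Tick\<close> in front of the word on tape 0.\<close>

definition repeat_word :: "instr list" where
  "repeat_word =
     repeat (copy_marked Eps @ while 0 (\<lambda>s. s \<noteq> Tick) (move 0 Go_left)) @ skip_word"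

lemma runs_repeat_word:
  assumes "\<sigma> 0 = zipper us (mark_word Sep w @ vs)" "\<sigma> 2 = zipper [] (replicate m Tick)"
    "\<sigma> 3 = end_of y"
  shows "runs repeat_word \<sigma> (m * (7 * length w + 14) + 3 * length w + 7)
    (\<sigma>(0 := zipper (us @ mark_word Sep w) vs,
       3 := end_of (y @ concat (replicate m (mark_word Eps w)))))"
proof -
  have body: "runs (copy_marked Eps @ while 0 (\<lambda>s. s \<noteq> Tick) (move 0 Go_left)) \<tau> (7 * length w + 8)
      (\<tau>(3 := end_of (y @ mark_word Eps w)))"
    if "\<tau> 0 = \<sigma> 0" "\<tau> 3 = end_of y" for \<tau> y
  proof -
    let ?\<rho> = "\<tau>(0 := zipper (us @ Tick # map Letter w) (Sep # vs), 3 := end_of (y @ mark_word Eps w))"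
    have 1: "runs (copy_marked Eps) \<tau> (4 * length w + 4) ?\<rho>"
      using that assms by (intro runs_copy_marked) auto
    have 2: "runs (while 0 (\<lambda>s. s \<noteq> Tick) (move 0 Go_left)) ?\<rho> (3 * length (map Letter w) + 4)
        (?\<rho>(0 := zipper us (Tick # map Letter w @ Sep # vs)))"
      by (intro scan_left) auto
    show ?thesis
      by (rule runs_conv[OF runs_seq[OF 1 2]])
        (use assms that in \<open>auto simp: mark_word_def fun_eq_iff\<close>)
  qed
  let ?\<tau> = "\<sigma>(3 := end_of (y @ concat (replicate m (mark_word Eps w))))"
  have 1: "runs (repeat (copy_marked Eps @ while 0 (\<lambda>s. s \<noteq> Tick) (move 0 Go_left))) \<sigma>
      (m * (7 * length w + 8 + 6) + 4) ?\<tau>"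
    using assms by (intro runs_repeat[where t = "\<sigma> 0"] body) auto
  have 2: "runs skip_word ?\<tau> (3 * length w + 3) (?\<tau>(0 := zipper (us @ mark_word Sep w) vs))"
    using assms by (intro runs_skip_word) auto
  show ?thesis unfolding repeat_word_def
    by (rule runs_conv[OF runs_seq[OF 1 2]]) (auto simp: fun_eq_iff algebra_simps)
qed

definition unroll_knapsack :: "instr list" where
  "unroll_knapsack = for_words repeat_word @ move 0 Go_right"

text \<open>
  A single \<open>N\<close> bounds the number of words, their lengths and \<open>m\<close>. This is crude, but still polynomial.
\<close>

lemma runs_unroll_knapsack:
  assumes "\<sigma> 0 = zipper [] (enc_list enc_word ws @ vs)" "\<sigma> 2 = zipper [] (replicate m Tick)"
    "\<sigma> 3 = end_of []" "length (enc_list enc_word ws) \<le> N" "m \<le> N"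
  shows "runs unroll_knapsack \<sigma> (N * (N * (7 * N + 14) + 3 * N + 9) + 2)
    (\<sigma>(0 := zipper (enc_list enc_word ws) vs, 3 := end_of (knapsack_script ws m)))"
proof -
  have len: "length ws \<le> N" and wlen: "\<And>w. w \<in> set ws \<Longrightarrow> length w \<le> N"
    using length_le_enc_list[of ws] word_length_le_enc_list[of _ ws] assms(4) by fastforce+
  let ?\<tau> = "\<sigma>(0 := zipper ([] @ concat (map (mark_word Sep) ws)) (Sep # vs),
     3 := end_of ([] @ concat (map (\<lambda>w. concat (replicate m (mark_word Eps w))) ws)))"
  have 1: "runs (for_words repeat_word) \<sigma> (length ws * ((N * (7 * N + 14) + 3 * N + 7) + 2) + 1) ?\<tau>"
  proof (rule runs_for_words[where t = "zipper [] (replicate m Tick)"])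
    fix \<tau> :: "nat \<Rightarrow> tape" and us w vs y
    assume *: "w \<in> set ws" "\<tau> 0 = zipper us (mark_word Sep w @ vs)"
      "\<tau> 2 = zipper [] (replicate m Tick)" "\<tau> 3 = end_of y"
    show "runs repeat_word \<tau> (N * (7 * N + 14) + 3 * N + 7)
      (\<tau>(0 := zipper (us @ mark_word Sep w) vs,
       3 := end_of (y @ concat (replicate m (mark_word Eps w)))))"
      using wlen[OF *(1)] assms(5)
      by (intro runs_mono[OF runs_repeat_word[OF *(2-4)]] add_mono mult_mono) auto
  qed (use assms in \<open>auto simp: enc_list_words\<close>)
  have 2: "runs (move 0 Go_right) ?\<tau> 1
     (?\<tau>(0 := zipper (([] @ concat (map (mark_word Sep) ws)) @ [Sep]) vs))"
    by (intro runs_right) auto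
  have "length ws * ((N * (7 * N + 14) + 3 * N + 7) + 2) \<le> N * (N * (7 * N + 14) + 3 * N + 9)"
    using len by (intro mult_mono) auto
  then show ?thesis unfolding unroll_knapsack_def
    by (intro runs_conv[OF runs_seq[OF 1 2]])
      (auto simp: fun_eq_iff enc_list_words knapsack_script_def)
qed

definition copy_layer :: "instr list" where
  "copy_layer = for_words (copy_marked Sep @ move 0 Go_right) @ put 3 Eps @ rewind 0"

definition unroll_membership :: "instr list" where
  "unroll_membership = repeat copy_layer @ for_words skip_word @ move 0 Go_right"

lemma runs_unroll_membership:
  assumes "\<sigma> 0 = zipper [] (enc_list enc_word ws @ vs)" "\<sigma> 2 = zipper [] (replicate m Tick)"
    "\<sigma> 3 = end_of []" "length (enc_list enc_word ws) \<le> N" "m \<le> N"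
  shows "runs unroll_membership \<sigma> (N * (N * (4 * N + 7) + 3 * N + 11) + N * (3 * N + 5) + 6)
    (\<sigma>(0 := zipper (enc_list enc_word ws) vs, 3 := end_of (membership_script ws m)))"
proof -
  let ?ws = "concat (map (mark_word Sep) ws)"
  have len: "length ws \<le> N" and wlen: "\<And>w. w \<in> set ws \<Longrightarrow> length w \<le> N"
    using length_le_enc_list[of ws] word_length_le_enc_list[of _ ws] assms(4) by fastforce+
  have len_ws: "length ?ws \<le> N" using assms(4) by (simp add: enc_list_words)
  have skipped: "concat (map (\<lambda>w. []) ws) = ([] :: symbol list)" by (induction ws) auto
  have layer: "runs copy_layer \<tau> (N * (4 * N + 7) + 3 * N + 5)
       (\<tau>(3 := end_of (y @ ?ws @ [Eps])))"
    if t: "\<tau> 0 = \<sigma> 0" "\<tau> 3 = end_of y" for \<tau> y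
  proof -
    let ?\<tau>1 = "\<tau>(0 := zipper ([] @ ?ws) (Sep # vs), 3 := end_of (y @ ?ws))"
    let ?\<tau>2 = "?\<tau>1(3 := end_of ((y @ ?ws) @ [Eps]))"
    have 1: "runs (for_words (copy_marked Sep @ move 0 Go_right)) \<tau> (length ws * ((4 * N + 5) + 2) + 1) ?\<tau>1"
    proof (rule runs_for_words[where t = "\<tau> 2"])
      fix \<tau> :: "nat \<Rightarrow> tape" and us w vs y
      assume *: "w \<in> set ws" "\<tau> 0 = zipper us (mark_word Sep w @ vs)" "\<tau> 3 = end_of y"
      let ?\<rho> = "\<tau>(0 := zipper (us @ Tick # map Letter w) (Sep # vs), 3 := end_of (y @ mark_word Sep w))"
      have 1: "runs (copy_marked Sep) \<tau> (4 * length w + 4) ?\<rho>"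
        by (rule runs_copy_marked[OF *(2,3)])
      have 2: "runs (move 0 Go_right) ?\<rho> 1 (?\<rho>(0 := zipper ((us @ Tick # map Letter w) @ [Sep]) vs))"
        by (intro runs_right) auto
      show "runs (copy_marked Sep @ move 0 Go_right) \<tau> (4 * N + 5)
        (\<tau>(0 := zipper (us @ mark_word Sep w) vs, 3 := end_of (y @ mark_word Sep w)))"
        by (rule runs_conv[OF runs_seq[OF 1 2]])
          (use wlen[OF *(1)] in \<open>auto simp: fun_eq_iff mark_word_def\<close>)
    qed (use assms t in \<open>auto simp: enc_list_words\<close>)
    have 2: "runs (put 3 Eps) ?\<tau>1 1 ?\<tau>2" by (intro runs_put) auto
    have 3: "runs (rewind 0) ?\<tau>2 (3 * length ?ws + 3) (?\<tau>2(0 := zipper [] (?ws @ Sep # vs)))"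
      by (intro runs_rewind) (auto simp: mark_word_def)
    have 4: "length ws * ((4 * N + 5) + 2) \<le> N * (4 * N + 7)" using len by (intro mult_mono) auto
    show ?thesis unfolding copy_layer_def
      by (rule runs_conv[OF runs_seq[OF 1 runs_seq[OF 2 3]]])
        (use assms t len_ws 4 in \<open>auto simp: fun_eq_iff enc_list_words\<close>)
  qed
  let ?\<sigma>1 = "\<sigma>(3 := end_of ([] @ concat (replicate m (?ws @ [Eps]))))"
  let ?\<sigma>2 = "?\<sigma>1(0 := zipper ([] @ ?ws) (Sep # vs),
      3 := end_of (([] @ concat (replicate m (?ws @ [Eps]))) @ concat (map (\<lambda>w. []) ws)))"
  have 1: "runs (repeat copy_layer) \<sigma> (m * ((N * (4 * N + 7) + 3 * N + 5) + 6) + 4) ?\<sigma>1"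
    using assms layer by (intro runs_repeat[where t = "\<sigma> 0"]) auto
  have 2: "runs (for_words skip_word) ?\<sigma>1 (length ws * ((3 * N + 3) + 2) + 1) ?\<sigma>2"
  proof (rule runs_for_words[where t = "zipper [] (replicate m Tick)"])
    fix \<tau> :: "nat \<Rightarrow> tape" and us w vs y
    assume *: "w \<in> set ws" "\<tau> 0 = zipper us (mark_word Sep w @ vs)" "\<tau> 3 = end_of y"
    show "runs skip_word \<tau> (3 * N + 3)
      (\<tau>(0 := zipper (us @ mark_word Sep w) vs, 3 := end_of (y @ [])))"
      by (rule runs_conv[OF runs_skip_word[where \<sigma> = \<tau> and us = us and w = w and vs = vs, OF *(2)]]) (use wlen[OF *(1)] *(3) in \<open>auto simp: fun_eq_iff\<close>)
  qed (use assms in \<open>auto simp: enc_list_words\<close>)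
  have 3: "runs (move 0 Go_right) ?\<sigma>2 1 (?\<sigma>2(0 := zipper (([] @ ?ws) @ [Sep]) vs))"
    by (intro runs_right) auto
  have "m * ((N * (4 * N + 7) + 3 * N + 5) + 6) \<le> N * (N * (4 * N + 7) + 3 * N + 11)"
    "length ws * ((3 * N + 3) + 2) \<le> N * (3 * N + 5)"
    using len assms(5) by (intro mult_mono; simp)+
  then show ?thesis unfolding unroll_membership_def
    by (intro runs_conv[OF runs_seq[OF 1 runs_seq[OF 2 3]]])
      (auto simp: fun_eq_iff enc_list_words membership_script_def skipped)
qed

text \<open>
  The bound comes last in the input, but it is needed first. It is copied to tape 2 from
  right to left, which does not matter for a unary number.
\<close>

definition load_bound :: "instr list" where
  "load_bound = while 0 (\<lambda>s. s \<noteq> Blank) (move 0 Go_right) @ move 0 Go_left @ move 0 Go_left @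
     while 0 (\<lambda>s. s = Tick) (put 2 Tick @ move 0 Go_left) @ rewind 0 @ rewind 2"

lemma runs_load_bound:
  assumes "\<sigma> 0 = zipper [] (us @ Sep # replicate m Tick @ [Sep])" "\<sigma> 2 = end_of []"
    "Blank \<notin> set us" "1 \<le> m"
  shows "runs load_bound \<sigma> (6 * length us + 10 * m + 17)
    (\<sigma>(2 := zipper [] (replicate m Tick)))"
proof -
  let ?x = "us @ Sep # replicate m Tick @ [Sep]"
  have loop: "runs (while 0 (\<lambda>s. s = Tick) (put 2 Tick @ move 0 Go_left)) \<tau> (4 * k + 5)
      (\<tau>(0 := zipper us (Sep # replicate (Suc k) Tick @ vs), 2 := end_of (replicate (Suc k + r) Tick)))"
    if "\<tau> 0 = zipper (us @ Sep # replicate k Tick) (Tick # vs)" "\<tau> 2 = end_of (replicate r Tick)"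
    for \<tau> k r vs
    using that
  proof (induction k arbitrary: \<tau> vs r)
    case 0
    let ?\<tau> = "\<tau>(2 := end_of (replicate r Tick @ [Tick]))"
    let ?\<rho> = "?\<tau>(0 := zipper us (Sep # Tick # vs))"
    have 1: "runs (put 2 Tick) \<tau> 1 ?\<tau>" using 0 by (intro runs_put) auto
    have 2: "runs (move 0 Go_left) ?\<tau> 1 ?\<rho>" using 0 by (intro runs_left) auto
    have 3: "runs (while 0 (\<lambda>s. s = Tick) (put 2 Tick @ move 0 Go_left)) ?\<rho> 1 ?\<rho>"
      by (intro runs_while_False) auto
    show ?case
      by (rule runs_conv[OF runs_while_True[OF _ _ runs_seq[OF 1 2] 3]])
        (use 0 in \<open>auto simp: fun_eq_iff replicate_append_same\<close>)
  next
    case (Suc k)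
    let ?\<tau> = "\<tau>(2 := end_of (replicate r Tick @ [Tick]))"
    let ?\<rho> = "?\<tau>(0 := zipper (us @ Sep # replicate k Tick) (Tick # Tick # vs))"
    have 1: "runs (put 2 Tick) \<tau> 1 ?\<tau>" using Suc.prems by (intro runs_put) auto
    have 2: "runs (move 0 Go_left) ?\<tau> 1 ?\<rho>"
      using Suc.prems by (intro runs_left) (auto simp: replicate_append_same)
    have 3: "runs (while 0 (\<lambda>s. s = Tick) (put 2 Tick @ move 0 Go_left)) ?\<rho> (4 * k + 5)
      (?\<rho>(0 := zipper us (Sep # replicate (Suc k) Tick @ Tick # vs),
          2 := end_of (replicate (Suc k + Suc r) Tick)))"
      by (intro Suc.IH) (auto simp: replicate_append_same)
    show ?case
      by (rule runs_conv[OF runs_while_True[OF _ _ runs_seq[OF 1 2] 3]])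
        (use Suc.prems in \<open>auto simp: fun_eq_iff replicate_app_Cons_same\<close>)
  qed
  obtain k where m: "m = Suc k" using assms(4) by (cases m) auto
  let ?\<sigma>1 = "\<sigma>(0 := zipper ([] @ ?x) [])"
  let ?\<sigma>2 = "?\<sigma>1(0 := zipper (us @ Sep # replicate m Tick) [Sep])"
  let ?\<sigma>3 = "?\<sigma>2(0 := zipper (us @ Sep # replicate k Tick) [Tick, Sep])"
  let ?\<sigma>4 = "?\<sigma>3(0 := zipper us (Sep # replicate (Suc k) Tick @ [Sep]), 2 := end_of (replicate (Suc k + 0) Tick))"
  let ?\<sigma>5 = "?\<sigma>4(0 := zipper [] (us @ Sep # replicate (Suc k) Tick @ [Sep]))"
  have 1: "runs (while 0 (\<lambda>s. s \<noteq> Blank) (move 0 Go_right)) \<sigma> (3 * length ?x + 1) ?\<sigma>1"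
    using assms by (intro scan_right) auto
  have 2: "runs (move 0 Go_left) ?\<sigma>1 1 ?\<sigma>2"
    by (intro runs_left) auto
  have 3: "runs (move 0 Go_left) ?\<sigma>2 1 ?\<sigma>3"
    by (intro runs_left) (auto simp: m replicate_append_same)
  have 4: "runs (while 0 (\<lambda>s. s = Tick) (put 2 Tick @ move 0 Go_left)) ?\<sigma>3 (4 * k + 5) ?\<sigma>4"
    using assms by (intro loop) auto
  have 5: "runs (rewind 0) ?\<sigma>4 (3 * length us + 3) ?\<sigma>5"
    using assms by (intro runs_rewind) auto
  have 6: "runs (rewind 2) ?\<sigma>5 (3 * length (replicate (Suc k + 0) Tick) + 3)
     (?\<sigma>5(2 := zipper [] (replicate (Suc k + 0) Tick @ [])))"
    by (intro runs_rewind) auto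
  show ?thesis unfolding load_bound_def
    by (rule runs_conv[OF runs_seq[OF 1 runs_seq[OF 2 runs_seq[OF 3 runs_seq[OF 4 runs_seq[OF 5 6]]]]]])
      (use assms in \<open>auto simp: fun_eq_iff m\<close>)
qed

text \<open>Subset sum is the bounded knapsack problem with bound 1.\<close>

definition load_one :: "instr list" where
  "load_one = put 2 Tick @ rewind 2"

lemma runs_load_one:
  assumes "\<sigma> 2 = end_of []"
  shows "runs load_one \<sigma> 7 (\<sigma>(2 := zipper [] (replicate 1 Tick)))"
proof -
  let ?\<sigma>1 = "\<sigma>(2 := end_of ([] @ [Tick]))"
  have 1: "runs (put 2 Tick) \<sigma> 1 ?\<sigma>1" using assms by (intro runs_put) auto
  have 2: "runs (rewind 2) ?\<sigma>1 (3 * length [Tick] + 3) (?\<sigma>1(2 := zipper [] ([Tick] @ [])))"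
    by (intro runs_rewind) auto
  show ?thesis unfolding load_one_def
    by (rule runs_conv[OF runs_seq[OF 1 2]]) (auto simp: fun_eq_iff)
qed

section \<open>Printing the graph\<close>

definition ticks :: "nat \<Rightarrow> symbol list" where
  "ticks n = replicate n Tick"

lemma ticks_append: "ticks m @ ticks n = ticks (m + n)"
  by (simp add: ticks_def replicate_add)

lemma ticks_simps: "ticks 0 = []" "ticks (Suc n) = Tick # ticks n" "length (ticks n) = n"
  by (auto simp: ticks_def)

lemma ticks_snoc: "ticks n @ [Tick] = ticks (Suc n)"
  by (simp add: ticks_def replicate_append_same)

lemma enc_unary_ticks: "enc_unary n = ticks n @ [Sep]"
  by (simp add: enc_unary_def ticks_def)

lemma ticks_enc_unary: "ticks m @ enc_unary n = enc_unary (m + n)"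
  by (simp add: enc_unary_def ticks_def replicate_add)

lemma length_enc_unary: "length (enc_unary n) = Suc n"
  by (simp add: enc_unary_def)

lemma scanned_ticks: "scanned (written (ticks c), q) = (if 0 \<le> q \<and> q < int c then Tick else Blank)"
  by (auto simp: scanned_def written_def ticks_def)

text \<open>
  The current position \<open>c\<close> is held on tape 4 in unary. Printing it three times over takes the head
  from one end of the counter to the other; as an edge needs the position twice, for its tail
  and for its head, one printing goes to the left and the other one back to the right.
\<close>

definition count_down :: "instr list" where
  "count_down = move 4 Go_left @ while 4 (\<lambda>s. s = Tick) (puts 1 (ticks 3) @ move 4 Go_left)"

definition count_up :: "instr list" where
  "count_up = move 4 Go_right @ while 4 (\<lambda>s. s = Tick) (puts 1 (ticks 3) @ move 4 Go_right)"

lemma runs_count_down: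
  assumes "\<sigma> 4 = end_of (ticks c)" "\<sigma> 1 = end_of y"
  shows "runs count_down \<sigma> (6 * c + 2)
     (\<sigma>(4 := (written (ticks c), -1), 1 := end_of (y @ ticks (3 * c))))"
proof -
  have loop: "runs (while 4 (\<lambda>s. s = Tick) (puts 1 (ticks 3) @ move 4 Go_left)) \<tau> (6 * q + 1)
     (\<tau>(4 := (written (ticks c), -1), 1 := end_of (y @ ticks (3 * q))))"
    if "\<tau> 4 = (written (ticks c), int q - 1)" "q \<le> c" "\<tau> 1 = end_of y" for \<tau> q y
    using that
  proof (induction q arbitrary: \<tau> y)
    case 0
    show ?case
      by (rule runs_conv[OF runs_while_False]) (use 0 in \<open>auto simp: scanned_ticks ticks_simps\<close>)
  next
    case (Suc q)
    let ?\<tau> = "\<tau>(1 := end_of (y @ ticks 3))"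
    let ?\<rho> = "?\<tau>(4 := (fst (?\<tau> 4), snd (?\<tau> 4) + offset Go_left))"
    have 1: "runs (puts 1 (ticks 3)) \<tau> (length (ticks 3)) ?\<tau>"
      using Suc.prems by (intro runs_puts) auto
    have 2: "runs (move 4 Go_left) ?\<tau> 1 ?\<rho>" by (intro runs_move) auto
    have 3: "runs (while 4 (\<lambda>s. s = Tick) (puts 1 (ticks 3) @ move 4 Go_left)) ?\<rho> (6 * q + 1)
      (?\<rho>(4 := (written (ticks c), -1), 1 := end_of ((y @ ticks 3) @ ticks (3 * q))))"
      using Suc.prems by (intro Suc.IH) auto
    show ?case
      by (rule runs_conv[OF runs_while_True[OF _ _ runs_seq[OF 1 2] 3]])
        (use Suc.prems in \<open>auto simp: fun_eq_iff scanned_ticks ticks_append ticks_simps(3)\<close>)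
  qed
  let ?\<tau> = "\<sigma>(4 := (fst (\<sigma> 4), snd (\<sigma> 4) + offset Go_left))"
  have 1: "runs (move 4 Go_left) \<sigma> 1 ?\<tau>" by (intro runs_move) auto
  have 2: "runs (while 4 (\<lambda>s. s = Tick) (puts 1 (ticks 3) @ move 4 Go_left)) ?\<tau> (6 * c + 1)
     (?\<tau>(4 := (written (ticks c), -1), 1 := end_of (y @ ticks (3 * c))))"
    using assms by (intro loop) (auto simp: zipper_def ticks_simps(3))
  show ?thesis unfolding count_down_def
    by (rule runs_conv[OF runs_seq[OF 1 2]]) (auto simp: fun_eq_iff)
qed

lemma runs_count_up:
  assumes "\<sigma> 4 = (written (ticks c), -1)" "\<sigma> 1 = end_of y"
  shows "runs count_up \<sigma> (6 * c + 2)
     (\<sigma>(4 := end_of (ticks c), 1 := end_of (y @ ticks (3 * c))))"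
proof -
  have loop: "runs (while 4 (\<lambda>s. s = Tick) (puts 1 (ticks 3) @ move 4 Go_right)) \<tau> (6 * q + 1)
     (\<tau>(4 := end_of (ticks c), 1 := end_of (y @ ticks (3 * q))))"
    if "\<tau> 4 = (written (ticks c), int c - int q)" "q \<le> c" "\<tau> 1 = end_of y" for \<tau> q y
    using that
  proof (induction q arbitrary: \<tau> y)
    case 0
    show ?case
      by (rule runs_conv[OF runs_while_False])
        (use 0 in \<open>auto simp: scanned_ticks ticks_simps zipper_def fun_eq_iff\<close>)
  next
    case (Suc q)
    let ?\<tau> = "\<tau>(1 := end_of (y @ ticks 3))"
    let ?\<rho> = "?\<tau>(4 := (fst (?\<tau> 4), snd (?\<tau> 4) + offset Go_right))"
    have 1: "runs (puts 1 (ticks 3)) \<tau> (length (ticks 3)) ?\<tau>"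
      using Suc.prems by (intro runs_puts) auto
    have 2: "runs (move 4 Go_right) ?\<tau> 1 ?\<rho>" by (intro runs_move) auto
    have 3: "runs (while 4 (\<lambda>s. s = Tick) (puts 1 (ticks 3) @ move 4 Go_right)) ?\<rho> (6 * q + 1)
      (?\<rho>(4 := end_of (ticks c), 1 := end_of ((y @ ticks 3) @ ticks (3 * q))))"
      using Suc.prems by (intro Suc.IH) auto
    show ?case
      by (rule runs_conv[OF runs_while_True[OF _ _ runs_seq[OF 1 2] 3]])
        (use Suc.prems in \<open>auto simp: fun_eq_iff scanned_ticks ticks_append ticks_simps(3)\<close>)
  qed
  let ?\<tau> = "\<sigma>(4 := (fst (\<sigma> 4), snd (\<sigma> 4) + offset Go_right))"
  have 1: "runs (move 4 Go_right) \<sigma> 1 ?\<tau>" by (intro runs_move) auto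
  have 2: "runs (while 4 (\<lambda>s. s = Tick) (puts 1 (ticks 3) @ move 4 Go_right)) ?\<tau> (6 * c + 1)
     (?\<tau>(4 := end_of (ticks c), 1 := end_of (y @ ticks (3 * c))))"
    using assms by (intro loop) auto
  show ?thesis unfolding count_up_def
    by (rule runs_conv[OF runs_seq[OF 1 2]]) (auto simp: fun_eq_iff)
qed

definition emit_edge :: "nat \<Rightarrow> (symbol \<Rightarrow> nat option) \<Rightarrow> nat \<Rightarrow> instr list" where
  "emit_edge i l j = put 1 Tick @ count_down @ puts 1 (enc_unary i) @
     [Write 1 3 (\<lambda>x. hd (enc_label (l x))) Go_right] @ count_up @ puts 1 (enc_unary (3 + j))"

lemma runs_emit_edge:
  assumes "\<sigma> 1 = end_of y" "scanned (\<sigma> 3) = x" "\<sigma> 4 = end_of (ticks c)"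
  shows "runs (emit_edge i l j) \<sigma> (12 * c + i + j + 11)
    (\<sigma>(1 := end_of (y @ Tick # enc_edge (edge_at c (i, l x, j)))))"
proof -
  let ?y1 = "y @ [Tick]"
  let ?y2 = "?y1 @ ticks (3 * c)"
  let ?y3 = "?y2 @ enc_unary i"
  let ?y4 = "?y3 @ [hd (enc_label (l x))]"
  let ?y5 = "?y4 @ ticks (3 * c)"
  let ?\<sigma>1 = "\<sigma>(1 := end_of ?y1)"
  let ?\<sigma>2 = "?\<sigma>1(4 := (written (ticks c), -1), 1 := end_of ?y2)"
  let ?\<sigma>3 = "?\<sigma>2(1 := end_of ?y3)"
  let ?\<sigma>4 = "?\<sigma>3(1 := end_of ?y4)"
  let ?\<sigma>5 = "?\<sigma>4(4 := end_of (ticks c), 1 := end_of ?y5)"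
  have 1: "runs (put 1 Tick) \<sigma> 1 ?\<sigma>1" using assms by (intro runs_put) auto
  have 2: "runs count_down ?\<sigma>1 (6 * c + 2) ?\<sigma>2" using assms by (intro runs_count_down) auto
  have 3: "runs (puts 1 (enc_unary i)) ?\<sigma>2 (length (enc_unary i)) ?\<sigma>3"
    by (intro runs_puts) auto
  have 4: "runs [Write 1 3 (\<lambda>x. hd (enc_label (l x))) Go_right] ?\<sigma>3 1 ?\<sigma>4"
    using assms by (intro runs_append) auto
  have 5: "runs count_up ?\<sigma>4 (6 * c + 2) ?\<sigma>5" by (intro runs_count_up) auto
  have 6: "runs (puts 1 (enc_unary (3 + j))) ?\<sigma>5 (length (enc_unary (3 + j)))
      (?\<sigma>5(1 := end_of (?y5 @ enc_unary (3 + j))))"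
    by (intro runs_puts) auto
  \<comment> \<open>The head lies in layer \<open>c + 1\<close>; its three extra ticks are printed as constants.\<close>
  have edge: "edge_at c (i, l x, j) = (3 * c + i, l x, 3 * c + (3 + j))" by simp
  have out: "?y5 @ enc_unary (3 + j) = y @ Tick # enc_edge (edge_at c (i, l x, j))"
    unfolding edge enc_edge.simps ticks_enc_unary[symmetric] by (cases "l x") simp_all
  show ?thesis unfolding emit_edge_def
    by (rule runs_conv[OF runs_seq[OF 1 runs_seq[OF 2 runs_seq[OF 3 runs_seq[OF 4 runs_seq[OF 5 6]]]]]])
      (use assms out in \<open>auto simp: fun_eq_iff length_enc_unary simp del: edge_at.simps enc_edge.simps\<close>)
qed

definition emit_moves ::
    "template list \<Rightarrow> instr list" where
  "emit_moves ts = concat (map (\<lambda>(b, i, l, j). when 3 b (emit_edge i l j)) ts)"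

definition enc_edges :: "edge list \<Rightarrow> symbol list" where
  "enc_edges es = concat (map (\<lambda>e. Tick # enc_edge e) es)"

text \<open>
  The bound on the states enters the time bound: an edge from state \<open>i\<close> to state \<open>j\<close> takes \<open>i + j\<close>
  ticks besides those for the positions.
\<close>

lemma runs_emit_moves:
  assumes "\<sigma> 1 = end_of y" "scanned (\<sigma> 3) = x" "\<sigma> 4 = end_of (ticks c)"
    "\<forall>(b, i, l, j)\<in>set ts. i \<le> 2 \<and> j \<le> 2"
  shows "runs (emit_moves ts) \<sigma> (length ts * (12 * c + 16))
    (\<sigma>(1 := end_of (y @ enc_edges (map (edge_at c) (moves_in ts x)))))"
  using assms(1-4)
proof (induction ts arbitrary: \<sigma> y)
  case Nil
  show ?case unfolding emit_moves_def
    by (rule runs_conv[of _ _ 0 \<sigma>])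
      (use Nil in \<open>auto intro: runs_Nil simp: moves_in_def enc_edges_def\<close>)
next
  case (Cons t ts)
  obtain b i l j where t: "t = (b, i, l, j)" by (cases t)
  let ?es = "if b x then Tick # enc_edge (edge_at c (i, l x, j)) else []"
  let ?\<tau> = "\<sigma>(1 := end_of (y @ ?es))"
  have 1: "runs (when 3 b (emit_edge i l j)) \<sigma> (12 * c + 16) ?\<tau>"
  proof (cases "b x")
    case True
    have "runs (emit_edge i l j) \<sigma> (12 * c + i + j + 11)
        (\<sigma>(1 := end_of (y @ Tick # enc_edge (edge_at c (i, l x, j)))))"
      using Cons.prems by (intro runs_emit_edge) auto
    then show ?thesis
      by (intro runs_conv[OF runs_when_True]) (use True Cons.prems t in auto)
  next
    case False
    then show ?thesis
      by (intro runs_conv[OF runs_when_False]) (use Cons.prems in auto)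
  qed
  have 2: "runs (emit_moves ts) ?\<tau> (length ts * (12 * c + 16))
      (?\<tau>(1 := end_of ((y @ ?es) @ enc_edges (map (edge_at c) (moves_in ts x)))))"
    using Cons.prems by (intro Cons.IH) auto
  have prog: "emit_moves (t # ts) = when 3 b (emit_edge i l j) @ emit_moves ts"
    by (simp add: emit_moves_def t)
  show ?case unfolding prog
    by (rule runs_conv[OF runs_seq[OF 1 2]])
      (auto simp: fun_eq_iff moves_in_def enc_edges_def t simp del: edge_at.simps)
qed

definition emit_edges :: "instr list" where
  "emit_edges =
     while 3 (\<lambda>s. s \<noteq> Blank) (emit_moves templates @ put 4 Tick @ move 3 Go_right)"

lemma runs_emit_edges:
  assumes "\<sigma> 1 = end_of y" "\<sigma> 3 = zipper us xs" "\<sigma> 4 = end_of (ticks c)" "Blank \<notin> set xs"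
    and "c + length xs \<le> K"
  shows "runs emit_edges \<sigma> (length xs * (84 * K + 116) + 1)
    (\<sigma>(1 := end_of (y @ enc_edges (unrolled_edges c xs)), 3 := end_of (us @ xs),
       4 := end_of (ticks (c + length xs))))"
  using assms
proof (induction xs arbitrary: \<sigma> y us c)
  case Nil
  show ?case unfolding emit_edges_def
    by (rule runs_conv[OF runs_while_False])
      (use Nil in \<open>auto simp: enc_edges_def fun_eq_iff\<close>)
next
  case (Cons x xs)
  let ?y = "y @ enc_edges (map (edge_at c) (moves_in templates x))"
  let ?\<sigma>1 = "\<sigma>(1 := end_of ?y)"
  let ?\<sigma>2 = "?\<sigma>1(4 := end_of (ticks c @ [Tick]))"
  let ?\<sigma>3 = "?\<sigma>2(3 := zipper (us @ [x]) xs)"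
  \<comment> \<open>There are seven templates, and each costs at most \<open>12 * K + 16\<close> steps.\<close>
  have "12 * c + 16 \<le> 12 * K + 16" using Cons.prems by simp
  then have bound: "length templates * (12 * c + 16) \<le> 84 * K + 112"
    by (simp add: templates_def)
  have 1: "runs (emit_moves templates) \<sigma> (84 * K + 112) ?\<sigma>1"
    using Cons.prems by (intro runs_mono[OF runs_emit_moves bound]) (auto simp: templates_def)
  have 2: "runs (put 4 Tick) ?\<sigma>1 1 ?\<sigma>2" using Cons.prems by (intro runs_put) auto
  have 3: "runs (move 3 Go_right) ?\<sigma>2 1 ?\<sigma>3" using Cons.prems by (intro runs_right) auto
  have 4: "runs emit_edges ?\<sigma>3 (length xs * (84 * K + 116) + 1)
    (?\<sigma>3(1 := end_of (?y @ enc_edges (unrolled_edges (Suc c) xs)), 3 := end_of ((us @ [x]) @ xs),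
       4 := end_of (ticks (Suc c + length xs))))"
    using Cons.prems by (intro Cons.IH) (auto simp: ticks_snoc)
  show ?case unfolding emit_edges_def
    by (rule runs_conv[OF runs_while_True[OF _ _ runs_seq[OF 1 runs_seq[OF 2 3]] 4[unfolded emit_edges_def]]])
      (use Cons.prems in \<open>auto simp: fun_eq_iff enc_edges_def\<close>)
qed

definition emit_size :: "instr list" where
  "emit_size = while 3 (\<lambda>s. s \<noteq> Blank) (puts 1 (ticks 3) @ move 3 Go_right) @ puts 1 (enc_unary 3)"

lemma runs_emit_size:
  assumes "\<sigma> 1 = end_of y" "\<sigma> 3 = zipper [] xs" "Blank \<notin> set xs"
  shows "runs emit_size \<sigma> (6 * length xs + 5)
    (\<sigma>(1 := end_of (y @ enc_unary (3 * length xs + 3)), 3 := end_of xs))"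
proof -
  let ?loop = "while 3 (\<lambda>s. s \<noteq> Blank) (puts 1 (ticks 3) @ move 3 Go_right)"
  have loop: "runs ?loop \<tau> (6 * length xs + 1)
      (\<tau>(1 := end_of (y @ ticks (3 * length xs)), 3 := end_of (us @ xs)))"
    if "\<tau> 1 = end_of y" "\<tau> 3 = zipper us xs" "Blank \<notin> set xs" for \<tau> y us xs
    using that
  proof (induction xs arbitrary: \<tau> y us)
    case Nil
    show ?case
      by (rule runs_conv[OF runs_while_False]) (use Nil in \<open>auto simp: ticks_simps fun_eq_iff\<close>)
  next
    case (Cons x xs)
    let ?\<tau> = "\<tau>(1 := end_of (y @ ticks 3))"
    let ?\<rho> = "?\<tau>(3 := zipper (us @ [x]) xs)"
    have 1: "runs (puts 1 (ticks 3)) \<tau> (length (ticks 3)) ?\<tau>"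
      using Cons.prems by (intro runs_puts) auto
    have 2: "runs (move 3 Go_right) ?\<tau> 1 ?\<rho>" using Cons.prems by (intro runs_right) auto
    have 3: "runs ?loop ?\<rho> (6 * length xs + 1)
      (?\<rho>(1 := end_of ((y @ ticks 3) @ ticks (3 * length xs)), 3 := end_of ((us @ [x]) @ xs)))"
      using Cons.prems by (intro Cons.IH) auto
    show ?case
      by (rule runs_conv[OF runs_while_True[OF _ _ runs_seq[OF 1 2] 3]])
        (use Cons.prems in \<open>auto simp: fun_eq_iff ticks_append ticks_simps(3)\<close>)
  qed
  let ?\<tau> = "\<sigma>(1 := end_of (y @ ticks (3 * length xs)), 3 := end_of ([] @ xs))"
  have 1: "runs ?loop \<sigma> (6 * length xs + 1) ?\<tau>" using assms by (intro loop) auto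
  have 2: "runs (puts 1 (enc_unary 3)) ?\<tau> (length (enc_unary 3))
      (?\<tau>(1 := end_of ((y @ ticks (3 * length xs)) @ enc_unary 3)))"
    by (intro runs_puts) auto
  have out: "ticks (3 * length xs) @ enc_unary 3 = enc_unary (3 * length xs + 3)"
    by (simp add: enc_unary_ticks ticks_append[symmetric])
  show ?thesis unfolding emit_size_def
    by (rule runs_conv[OF runs_seq[OF 1 2]]) (use out in \<open>auto simp: fun_eq_iff length_enc_unary\<close>)
qed

text \<open>
  The number of vertices comes first in the output and requires a pass of its own over the script.
  After the edges, the initial vertex \<open>0\<close> is a single separator, and the final vertex is three times
  the value that the counter has reached. The head on tape 0 has been waiting in front of \<open>g\<close>.
\<close>

definition emit_graph :: "instr list" where
  "emit_graph = rewind 3 @ emit_size @ rewind 3 @ emit_edges @ puts 1 [Sep, Sep] @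
     count_down @ put 1 Sep @ copy_letters 0 1 @ put 1 Sep"

lemma runs_emit_graph:
  assumes "\<sigma> 0 = zipper us (enc_word g @ vs)" "\<sigma> 1 = end_of []" "\<sigma> 3 = end_of xs"
    "\<sigma> 4 = end_of []" "Blank \<notin> set xs"
  shows "\<exists>\<tau>. runs emit_graph \<sigma> (length xs * (84 * length xs + 134) + 4 * length g + 19) \<tau> \<and>
     fst (\<tau> 1) = written (enc_AGWP (unrolled_graph xs g))"
proof -
  let ?K = "length xs"
  let ?y2 = "[] @ enc_unary (3 * ?K + 3)"
  let ?y4 = "?y2 @ enc_edges (unrolled_edges 0 xs)"
  let ?y5 = "?y4 @ [Sep, Sep]"
  let ?y6 = "?y5 @ ticks (3 * ?K)"
  let ?y7 = "?y6 @ [Sep]"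
  let ?y8 = "?y7 @ map Letter g"
  let ?\<sigma>1 = "\<sigma>(3 := zipper [] (xs @ []))"
  let ?\<sigma>2 = "?\<sigma>1(1 := end_of ?y2, 3 := end_of xs)"
  let ?\<sigma>3 = "?\<sigma>2(3 := zipper [] (xs @ []))"
  let ?\<sigma>4 = "?\<sigma>3(1 := end_of ?y4, 3 := end_of ([] @ xs), 4 := end_of (ticks (0 + ?K)))"
  let ?\<sigma>5 = "?\<sigma>4(1 := end_of ?y5)"
  let ?\<sigma>6 = "?\<sigma>5(4 := (written (ticks ?K), -1), 1 := end_of ?y6)"
  let ?\<sigma>7 = "?\<sigma>6(1 := end_of ?y7)"
  let ?\<sigma>8 = "?\<sigma>7(0 := zipper (us @ map Letter g) (Sep # vs), 1 := end_of ?y8)"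
  have 1: "runs (rewind 3) \<sigma> (3 * ?K + 3) ?\<sigma>1" using assms by (intro runs_rewind) auto
  have 2: "runs emit_size ?\<sigma>1 (6 * ?K + 5) ?\<sigma>2" using assms by (intro runs_emit_size) auto
  have 3: "runs (rewind 3) ?\<sigma>2 (3 * ?K + 3) ?\<sigma>3" using assms by (intro runs_rewind) auto
  have 4: "runs emit_edges ?\<sigma>3 (?K * (84 * ?K + 116) + 1) ?\<sigma>4"
    using assms by (intro runs_emit_edges) (auto simp: ticks_simps)
  have 5: "runs (puts 1 [Sep, Sep]) ?\<sigma>4 (length [Sep, Sep]) ?\<sigma>5" by (intro runs_puts) auto
  have 6: "runs count_down ?\<sigma>5 (6 * ?K + 2) ?\<sigma>6" by (intro runs_count_down) auto
  have 7: "runs (put 1 Sep) ?\<sigma>6 1 ?\<sigma>7" by (intro runs_put) auto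
  have 8: "runs (copy_letters 0 1) ?\<sigma>7 (4 * length g + 1) ?\<sigma>8"
    using assms by (intro runs_copy_letters) (auto simp: enc_word_def)
  have 9: "runs (put 1 Sep) ?\<sigma>8 1 (?\<sigma>8(1 := end_of (?y8 @ [Sep])))" by (intro runs_put) auto
  have "enc_AGWP (unrolled_graph xs g) = ?y8 @ [Sep]"
    by (simp add: unrolled_graph_def enc_list_def enc_edges_def enc_unary_ticks ticks_simps enc_word_def)
  moreover have "runs emit_graph \<sigma> (?K * (84 * ?K + 134) + 4 * length g + 19)
      (?\<sigma>8(1 := end_of (?y8 @ [Sep])))"
    unfolding emit_graph_def
    by (rule runs_mono[OF runs_seq[OF 1 runs_seq[OF 2 runs_seq[OF 3 runs_seq[OF 4 runs_seq[OF 5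
      runs_seq[OF 6 runs_seq[OF 7 runs_seq[OF 8 9]]]]]]]]]) (simp add: algebra_simps)
  ultimately show ?thesis by (intro exI[of _ "?\<sigma>8(1 := end_of (?y8 @ [Sep]))"]) simp
qed

section \<open>Alphabets\<close>

definition tape_symbols :: "'g list \<Rightarrow> symbol set" where
  "tape_symbols X = insert Blank (script_symbols X)"

lemma tape_symbols_basic: "{Blank, Sep, Tick, Eps} \<subseteq> tape_symbols X"
  by (auto simp: tape_symbols_def script_symbols_def)

text \<open>
  The symbols written are constants or copies of scanned symbols, so every alphabet that contains
  the constants will do.
\<close>

definition prog_ok :: "symbol set \<Rightarrow> instr list \<Rightarrow> bool" where
  "prog_ok A P \<longleftrightarrow> (\<forall>c\<in>set P. instr_ok A c)"

lemma prog_ok_simps [simp]: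
  "prog_ok A (P @ Q) \<longleftrightarrow> prog_ok A P \<and> prog_ok A Q"
  "prog_ok A (while i b P) \<longleftrightarrow> prog_ok A P"
  "prog_ok A (when i b P) \<longleftrightarrow> prog_ok A P"
  "prog_ok A (move i d) \<longleftrightarrow> i < 5"
  "prog_ok A (Write i j f d # P) \<longleftrightarrow> j < 5 \<and> (\<forall>a\<in>A. f a \<in> A) \<and> prog_ok A P"
  "prog_ok A []"
  by (auto simp: prog_ok_def while_def when_def move_def)

lemma prog_ok_put: "a \<in> A \<Longrightarrow> i < 5 \<Longrightarrow> prog_ok A (put i a)"
  by (simp add: put_def)

lemma prog_ok_puts: "set ys \<subseteq> A \<Longrightarrow> i < 5 \<Longrightarrow> prog_ok A (puts i ys)"
  by (induction ys) (auto simp: puts_def put_def prog_ok_def)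

lemma prog_ok_rewind: "i < 5 \<Longrightarrow> prog_ok A (rewind i)"
  by (simp add: rewind_def)

lemma prog_ok_copy_letters: "i < 5 \<Longrightarrow> j < 5 \<Longrightarrow> prog_ok A (copy_letters j i)"
  unfolding copy_letters_def by simp

lemma prog_ok_emit_edge:
  assumes "\<forall>a\<in>A. hd (enc_label (l a)) \<in> A" "Sep \<in> A" "Tick \<in> A"
  shows "prog_ok A (emit_edge i l j)"
proof -
  have "set (enc_unary n) \<subseteq> A" "set (ticks n) \<subseteq> A" for n
    using assms by (auto simp: enc_unary_def ticks_def)
  then show ?thesis
    using assms by (simp add: emit_edge_def count_down_def count_up_def prog_ok_put prog_ok_puts)
qed

lemma prog_ok_emit_graph: "prog_ok (tape_symbols X) (emit_graph)"
proof -
  let ?A = "tape_symbols X"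
  have A: "Sep \<in> ?A" "Tick \<in> ?A" "Eps \<in> ?A" using tape_symbols_basic[of X] by auto
  have "hd (enc_label (case a of Letter n \<Rightarrow> Some n | _ \<Rightarrow> None)) \<in> ?A" if "a \<in> ?A" for a
    using that A by (cases a) auto
  then have "prog_ok ?A (emit_moves templates)"
    using A by (simp add: emit_moves_def templates_def prog_ok_emit_edge)
  moreover have "set (enc_unary n) \<subseteq> ?A" "set (ticks n) \<subseteq> ?A" for n
    using A by (auto simp: enc_unary_def ticks_def)
  ultimately show ?thesis
    using A by (simp add: emit_graph_def emit_size_def emit_edges_def count_down_def
      prog_ok_put prog_ok_puts prog_ok_rewind prog_ok_copy_letters)
qed

lemma prog_ok_unroll:
  "prog_ok (tape_symbols X) load_one" "prog_ok (tape_symbols X) load_bound"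
  "prog_ok (tape_symbols X) unroll_knapsack" "prog_ok (tape_symbols X) unroll_membership"
  using tape_symbols_basic[of X]
  by (simp_all add: load_one_def load_bound_def unroll_knapsack_def unroll_membership_def
      for_words_def repeat_word_def repeat_def copy_layer_def copy_marked_def skip_word_def
      prog_ok_put prog_ok_rewind prog_ok_copy_letters)

section \<open>The reductions\<close>

definition start :: "symbol list \<Rightarrow> nat \<Rightarrow> tape" where
  "start x = (\<lambda>_. end_of [])(0 := zipper [] x)"

lemma polytime_computableI:
  assumes "prog_ok (tape_symbols X) P"
    and "\<And>u. u \<in> instances A \<Longrightarrow> set (encoding A u) \<subseteq> tape_symbols X"
    and "\<And>u. u \<in> instances A \<Longrightarrow>
      \<exists>\<tau>. runs P (start (encoding A u)) (poly p (length (encoding A u))) \<tau> \<and>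
          fst (\<tau> 1) = written (encoding B (f u))"
  shows "polytime_computable A B f"
proof -
  have "wf_tm (machine (tape_symbols X) P)"
    using assms(1) by (intro wf_machine) (auto simp: prog_ok_def tape_symbols_def script_symbols_def)
  moreover have "tm_computes_within (machine (tape_symbols X) P) (encoding A u) (encoding B (f u))
      (poly p (length (encoding A u)))" if "u \<in> instances A" for u
    using assms(3)[OF that] runs_computes by (fastforce simp: start_def zipper_def)
  ultimately show ?thesis
    unfolding polytime_computable_def using assms(2)
    by (intro exI[of _ "machine (tape_symbols X) P"] exI[of _ p]) (auto simp: machine_def)
qed

definition script_poly :: "nat poly" where
  "script_poly = [:0, 1:] * [:0, 1:]"

text \<open>
  The summands bound the three phases as functions of the length \<open>N\<close> of the input: loading,
  writing the script (\<open>t\<close>), and printing the graph and the word \<open>g\<close> for a script of length at most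
  \<open>N * N\<close>.
\<close>

definition graph_poly :: "nat poly \<Rightarrow> nat poly" where
  "graph_poly t = [:17, 16:] + t + script_poly * ([:84:] * script_poly + [:134:]) + [:19, 4:]"

text \<open>
  The three reductions differ only in how the bound is loaded and in which script is written;
  \<open>vs\<close> is the part of the input behind \<open>g\<close>.
\<close>

lemma runs_reduction:
  assumes load: "runs load (start (enc_list enc_word ws @ enc_word g @ vs)) n
      ((start (enc_list enc_word ws @ enc_word g @ vs))(2 := zipper [] (replicate m Tick)))"
    and unroll: "\<And>\<sigma> vs. \<sigma> 0 = zipper [] (enc_list enc_word ws @ vs) \<Longrightarrow>
      \<sigma> 2 = zipper [] (replicate m Tick) \<Longrightarrow> \<sigma> 3 = end_of [] \<Longrightarrow>
      runs unroll \<sigma> (poly t N) (\<sigma>(0 := zipper (enc_list enc_word ws) vs, 3 := end_of xs))"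
    and "length xs \<le> m * length (enc_list enc_word ws)" "Blank \<notin> set xs"
    and "length (enc_list enc_word ws) \<le> N" "m \<le> N" "length g \<le> N" "n \<le> 16 * N + 17"
  shows "\<exists>\<tau>. runs (load @ unroll @ emit_graph) (start (enc_list enc_word ws @ enc_word g @ vs))
      (poly (graph_poly t) N) \<tau> \<and> fst (\<tau> 1) = written (enc_AGWP (unrolled_graph xs g))"
proof -
  let ?\<sigma> = "start (enc_list enc_word ws @ enc_word g @ vs)"
  let ?\<sigma>1 = "?\<sigma>(2 := zipper [] (replicate m Tick))"
  let ?\<sigma>2 = "?\<sigma>1(0 := zipper (enc_list enc_word ws) (enc_word g @ vs), 3 := end_of xs)"
  have 2: "runs unroll ?\<sigma>1 (poly t N) ?\<sigma>2"
    by (intro unroll) (auto simp: start_def)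
  obtain \<tau> where 3: "runs emit_graph ?\<sigma>2 (length xs * (84 * length xs + 134) + 4 * length g + 19) \<tau>"
    and out: "fst (\<tau> 1) = written (enc_AGWP (unrolled_graph xs g))"
    using runs_emit_graph[of ?\<sigma>2 "enc_list enc_word ws" g vs xs] assms(4) by (auto simp: start_def)
  have "length xs \<le> N * N"
    using assms(3) mult_mono[OF assms(6,5)] by simp
  then have "length xs * (84 * length xs + 134) \<le> N * N * (84 * (N * N) + 134)"
    by (intro mult_mono) auto
  then have "runs (load @ unroll @ emit_graph) ?\<sigma> (poly (graph_poly t) N) \<tau>"
    using assms(7,8)
    by (intro runs_mono[OF runs_seq[OF load runs_seq[OF 2 3]]])
      (simp add: graph_poly_def script_poly_def algebra_simps)
  with out show ?thesis by blast
qed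

definition knapsack_poly :: "nat poly" where
  "knapsack_poly = (let x = [:0, 1:] in x * (x * [:14, 7:] + [:9, 3:]) + [:2:])"

definition membership_poly :: "nat poly" where
  "membership_poly = (let x = [:0, 1:] in x * (x * [:7, 4:] + [:11, 3:]) + x * [:5, 3:] + [:6:])"

lemma runs_unroll_knapsack_poly:
  assumes "\<sigma> 0 = zipper [] (enc_list enc_word ws @ vs)" "\<sigma> 2 = zipper [] (replicate m Tick)"
    "\<sigma> 3 = end_of []" "length (enc_list enc_word ws) \<le> N" "m \<le> N"
  shows "runs unroll_knapsack \<sigma> (poly knapsack_poly N)
    (\<sigma>(0 := zipper (enc_list enc_word ws) vs, 3 := end_of (knapsack_script ws m)))"
  by (rule runs_mono[OF runs_unroll_knapsack[OF assms]])
    (simp add: knapsack_poly_def Let_def algebra_simps)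

lemma runs_unroll_membership_poly:
  assumes "\<sigma> 0 = zipper [] (enc_list enc_word ws @ vs)" "\<sigma> 2 = zipper [] (replicate m Tick)"
    "\<sigma> 3 = end_of []" "length (enc_list enc_word ws) \<le> N" "m \<le> N"
  shows "runs unroll_membership \<sigma> (poly membership_poly N)
    (\<sigma>(0 := zipper (enc_list enc_word ws) vs, 3 := end_of (membership_script ws m)))"
  by (rule runs_mono[OF runs_unroll_membership[OF assms]])
    (simp add: membership_poly_def Let_def algebra_simps)

lemma runs_bounded:
  assumes unroll: "\<And>\<sigma> vs ws m N. \<sigma> 0 = zipper [] (enc_list enc_word ws @ vs) \<Longrightarrow>
      \<sigma> 2 = zipper [] (replicate m Tick) \<Longrightarrow> \<sigma> 3 = end_of [] \<Longrightarrow>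
      length (enc_list enc_word ws) \<le> N \<Longrightarrow> m \<le> N \<Longrightarrow>
      runs unroll \<sigma> (poly t N) (\<sigma>(0 := zipper (enc_list enc_word ws) vs, 3 := end_of (script ws m)))"
    and "\<And>ws m. length (script ws m) \<le> m * length (enc_list enc_word ws)"
    and "\<And>ws m. set ws \<subseteq> words X \<Longrightarrow> set (script ws m) \<subseteq> script_symbols X"
    and inst: "instance_bounded X (gs, g, m)"
  shows "\<exists>\<tau>. runs (load_bound @ unroll @ emit_graph) (start (enc_bounded (gs, g, m)))
      (poly (graph_poly t) (length (enc_bounded (gs, g, m)))) \<tau> \<and>
      fst (\<tau> 1) = written (enc_AGWP (unrolled_graph (script gs m) g))"
proof -
  let ?N = "length (enc_bounded (gs, g, m))"
  let ?x = "enc_list enc_word gs @ enc_word g @ enc_unary m"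
  let ?us = "enc_list enc_word gs @ map Letter g"
  have words: "set gs \<subseteq> words X" "g \<in> words X" "1 \<le> m" using inst by auto
  have x: "?x = ?us @ Sep # replicate m Tick @ [Sep]" by (simp add: enc_word_def enc_unary_def)
  have "Blank \<notin> set ?us"
    using Blank_not_script[OF set_enc_list_words[OF words(1)]] by auto
  then have "runs load_bound (start ?x) (6 * length ?us + 10 * m + 17)
      ((start ?x)(2 := zipper [] (replicate m Tick)))"
    using words(3) unfolding x by (intro runs_load_bound) (auto simp: start_def)
  then have "\<exists>\<tau>. runs (load_bound @ unroll @ emit_graph) (start ?x) (poly (graph_poly t) ?N) \<tau> \<and>
      fst (\<tau> 1) = written (enc_AGWP (unrolled_graph (script gs m) g))"
    using assms(2) Blank_not_script[OF assms(3)[OF words(1)]]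
    by (intro runs_reduction[where N = ?N] unroll)
      (auto simp: enc_word_def enc_unary_def)
  then show ?thesis by simp
qed

lemma set_enc_bounded: "instance_bounded X u \<Longrightarrow> set (enc_bounded u) \<subseteq> tape_symbols X"
  using set_enc_list_words[of _ X] set_enc_word[of _ X]
  by (cases u) (fastforce simp: tape_symbols_def script_symbols_def enc_unary_def)

text \<open>
  The two problems with a bound have the same instances, and the machines for them share the first and
  the last phase; only the script depends on the problem.
\<close>

lemma bounded_reducible:
  fixes D :: "bounded_instance decision_problem"
  assumes unroll: "\<And>\<sigma> vs ws m N. \<sigma> 0 = zipper [] (enc_list enc_word ws @ vs) \<Longrightarrow>
      \<sigma> 2 = zipper [] (replicate m Tick) \<Longrightarrow> \<sigma> 3 = end_of [] \<Longrightarrow>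
      length (enc_list enc_word ws) \<le> N \<Longrightarrow> m \<le> N \<Longrightarrow>
      runs unroll \<sigma> (poly t N) (\<sigma>(0 := zipper (enc_list enc_word ws) vs, 3 := end_of (script ws m)))"
    and ok: "prog_ok (tape_symbols X) unroll"
    and len: "\<And>ws m. length (script ws m) \<le> m * length (enc_list enc_word ws)"
    and set: "\<And>ws m. set ws \<subseteq> words X \<Longrightarrow> set (script ws m) \<subseteq> script_symbols X"
    and D: "instances D = {u. instance_bounded X u}" "encoding D = enc_bounded"
    and pos: "\<And>gs g m. instance_bounded X (gs, g, m) \<Longrightarrow>
      (gs, g, m) \<in> positives D \<longleftrightarrow> positive_AGWP G X (unrolled_graph (script gs m) g)"
  shows "P_reducible D (AGWP G X)"
proof -
  define f where "f = (\<lambda>(gs, g, m). unrolled_graph (script gs m) g)"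
  have inst: "instance_AGWP X (f u)" if "u \<in> instances D" for u
    using that set by (cases u) (auto simp: D f_def simp del: instance_AGWP.simps
        intro!: instance_unrolled_graph)
  have "polytime_computable D (AGWP G X) f"
  proof (rule polytime_computableI)
    show "prog_ok (tape_symbols X) (load_bound @ unroll @ emit_graph)"
      using ok by (simp add: prog_ok_unroll prog_ok_emit_graph)
  next
    fix u assume u: "u \<in> instances D"
    then show "set (encoding D u) \<subseteq> tape_symbols X"
      using set_enc_bounded[of X u] by (simp add: D)
    show "\<exists>\<tau>. runs (load_bound @ unroll @ emit_graph) (start (encoding D u))
          (poly (graph_poly t) (length (encoding D u))) \<tau> \<and>
        fst (\<tau> 1) = written (encoding (AGWP G X) (f u))"
    proof (cases u)
      case (fields gs g m)
      then have "instance_bounded X (gs, g, m)" using u by (simp add: D)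
      from runs_bounded[where script = script, OF unroll len set this]
      show ?thesis by (simp add: D AGWP_def f_def fields del: enc_bounded.simps enc_AGWP.simps)
    qed
  qed
  moreover have "u \<in> positives D \<longleftrightarrow> f u \<in> positives (AGWP G X)" if "u \<in> instances D" for u
    using that pos inst[OF that]
    by (cases u) (simp add: D AGWP_def f_def del: instance_AGWP.simps positive_AGWP.simps)
  ultimately show ?thesis
    unfolding P_reducible_def using inst by (intro exI[of _ f]) (auto simp: AGWP_def)
qed

lemma (in monoid) BKP_reducible:
  assumes "set X \<subseteq> carrier G"
  shows "P_reducible (BKP G X) (AGWP G X)"
proof (rule bounded_reducible[OF runs_unroll_knapsack_poly prog_ok_unroll(3)
      length_knapsack_script set_knapsack_script])
  show "(gs, g, m) \<in> positives (BKP G X) \<longleftrightarrow>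
      positive_AGWP G X (unrolled_graph (knapsack_script gs m) g)"
    if "instance_bounded X (gs, g, m)" for gs g m
    using that positive_BKP_iff[OF assms, of gs g m]
    by (simp add: BKP_def del: positive_BKP.simps positive_AGWP.simps)
qed (simp_all add: BKP_def)

lemma (in monoid) BSMP_reducible:
  assumes "set X \<subseteq> carrier G"
  shows "P_reducible (BSMP G X) (AGWP G X)"
proof (rule bounded_reducible[OF runs_unroll_membership_poly prog_ok_unroll(4)
      length_membership_script set_membership_script])
  show "(gs, g, m) \<in> positives (BSMP G X) \<longleftrightarrow>
      positive_AGWP G X (unrolled_graph (membership_script gs m) g)"
    if "instance_bounded X (gs, g, m)" for gs g m
    using that positive_BSMP_iff[OF assms, of gs g m]
    by (simp add: BSMP_def del: positive_BSMP.simps positive_AGWP.simps)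
qed (simp_all add: BSMP_def)

lemma runs_SSP:
  assumes "instance_SSP X (gs, g)"
  shows "\<exists>\<tau>. runs (load_one @ unroll_knapsack @ emit_graph) (start (enc_SSP (gs, g)))
      (poly (graph_poly knapsack_poly) (length (enc_SSP (gs, g)))) \<tau> \<and>
      fst (\<tau> 1) = written (enc_AGWP (unrolled_graph (knapsack_script gs 1) g))"
proof -
  let ?N = "length (enc_SSP (gs, g))"
  let ?x = "enc_list enc_word gs @ enc_word g @ []"
  have "set gs \<subseteq> words X" using assms by auto
  note Blank_not_script[OF set_knapsack_script[OF this]]
  moreover have "runs load_one (start ?x) 7 ((start ?x)(2 := zipper [] (replicate 1 Tick)))"
    by (intro runs_load_one) (simp add: start_def)
  ultimately have "\<exists>\<tau>. runs (load_one @ unroll_knapsack @ emit_graph) (start ?x)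
      (poly (graph_poly knapsack_poly) ?N) \<tau> \<and>
      fst (\<tau> 1) = written (enc_AGWP (unrolled_graph (knapsack_script gs 1) g))"
    by (intro runs_reduction[where N = ?N and n = 7 and m = 1] runs_unroll_knapsack_poly length_knapsack_script)
      (auto simp: enc_word_def)
  then show ?thesis by simp
qed

lemma (in monoid) SSP_reducible:
  assumes "set X \<subseteq> carrier G"
  shows "P_reducible (SSP G X) (AGWP G X)"
  unfolding P_reducible_def
proof (intro exI[of _ "\<lambda>(gs, g). unrolled_graph (knapsack_script gs 1) g"] conjI ballI)
  show "(\<lambda>(gs, g). unrolled_graph (knapsack_script gs 1) g) \<in> instances (SSP G X) \<rightarrow> instances (AGWP G X)"
    by (auto simp: SSP_def AGWP_def simp del: instance_AGWP.simps
        intro!: instance_unrolled_graph set_knapsack_script)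
  show "polytime_computable (SSP G X) (AGWP G X) (\<lambda>(gs, g). unrolled_graph (knapsack_script gs 1) g)"
  proof (rule polytime_computableI)
    show "prog_ok (tape_symbols X) (load_one @ unroll_knapsack @ emit_graph)"
      by (simp add: prog_ok_unroll prog_ok_emit_graph)
  next
    fix u assume u: "u \<in> instances (SSP G X)"
    obtain gs g where ueq: "u = (gs, g)" by (cases u)
    show "set (encoding (SSP G X) u) \<subseteq> tape_symbols X"
      using u set_enc_list_words[of gs X] set_enc_word[of g X]
      by (auto simp: SSP_def ueq tape_symbols_def)
    show "\<exists>\<tau>. runs (load_one @ unroll_knapsack @ emit_graph) (start (encoding (SSP G X) u))
          (poly (graph_poly knapsack_poly) (length (encoding (SSP G X) u))) \<tau> \<and>
        fst (\<tau> 1) = written (encoding (AGWP G X) (case u of (gs, g) \<Rightarrow> unrolled_graph (knapsack_script gs 1) g))"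
      using u runs_SSP[of X gs g]
      by (simp add: SSP_def AGWP_def ueq del: enc_SSP.simps enc_AGWP.simps)
  qed
next
  fix u assume "u \<in> instances (SSP G X)"
  then show "u \<in> positives (SSP G X) \<longleftrightarrow>
      (case u of (gs, g) \<Rightarrow> unrolled_graph (knapsack_script gs 1) g) \<in> positives (AGWP G X)"
    using instance_unrolled_graph[OF set_knapsack_script, of _ X] positive_BKP_iff[OF assms]
    by (cases u) (simp add: SSP_def AGWP_def positive_SSP_iff
        del: instance_AGWP.simps positive_SSP.simps positive_BKP.simps positive_AGWP.simps)
qed

theorem proposition4:
  fixes G :: "('g, 'b) monoid_scheme" and X :: "'g list"
  assumes "monoid G" and "generated_by G X"
  shows "P_reducible (SSP G X) (AGWP G X) \<and>
         P_reducible (BKP G X) (AGWP G X) \<and>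
         P_reducible (BSMP G X) (AGWP G X)"
proof -
  interpret monoid G by fact
  have "set X \<subseteq> carrier G" using assms(2) unfolding generated_by_def by blast
  then show ?thesis by (intro conjI SSP_reducible BKP_reducible BSMP_reducible)
qed

end
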